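(* Let $\mathbb F\in\{\mathbb R,\mathbb C\}$, let $k\ge2$, and consider a row separation problem with row blocks $\{D_1,\dots,D_{k+1}\}$ over $\mathbb F$ that is a $k$-division problem or (for $k\ge3$) a loose $k$-division problem. Then the problem is also a $(k+1)$-division problem or a loose $(k+1)$-division problem if and only if for every ordering $(j_1,\dots,j_{k+1})$ of $\{1,\dots,k+1\}$ the covariance matrix $$\mathrm{Cov}^{(j_1,\dots,j_{k+1})}=D_{j_1}^T\bar D_{j_1}D_{j_2}^T\bar D_{j_2}\cdots D_{j_{k+1}}^T\bar D_{j_{k+1}}D_{j_1}^T\bar D_{j_1}$$ has at most one nonzero eigenvalue (counted without multiplicity).
   Context: $\mathcal R(\cdot)$ is the column space over $\mathbb F$, $\bar{\ }$ is entrywise conjugation, and orthogonality is with respect to the standard inner product. Eigenvalues of matrices are taken in $\mathbb{C}$. Row separation problem. It is given by row blocks $D_j\in\mathbb F^{r_j\times\hat d}$ ($j=1,\dots,k+1$), each of full row rank, stacked into $D=[D_1^T\cdots D_{k+1}^T]^T$. A solution consists of a permutation matrix $E$, unitary (orthogonal if $\mathbb F=\mathbb R$) matrices $H_j$ of size $r_j$, a unitary (orthogonal if $\mathbb F=\mathbb R$) $L$ of size $\hat d$ and a block diagonal matrix (any number $g$ of blocks) with $E\,\mathrm{diag}\{H_1,\dots,H_{k+1}\}DL=\mathrm{diag}\{B_1,\dots,B_g\}$. A row separation subspace is a nonzero subspace $\mathcal S\subseteq\mathbb F^{\hat d}$ such that for some solution and some $t$, $\mathcal S=\mathcal R(\bar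 L (B_t')^T)$, where $B_t'=[0\ \cdots\ B_t\ \cdots\ 0]$ is the block row (with $\hat d$ columns) of $\mathrm{diag}\{B_1,\dots,B_g\}$ containing $B_t$. For $\{C\}\subset\{1,\dots,k+1\}$, the $\{C\}$-subset subproblem is the row separation problem with blocks $D_j$, $j\in\{C\}$. Division problems (eigenvalues and singular values are counted without multiplicity). 1-division: each $\bar D_jD_j^T$ has exactly one eigenvalue and each $\mathrm{rank}(D_j)\ge 2$. 2-division: it is 1-division; each $\bar D_jD_{j'}^T$ has exactly one singular value, meaning that it is a scalar multiple (possibly zero) of a unitary matrix (for nonzero ones this forces $r_j=r_{j'}$); and the graph on $\{1,\dots,k+1\}$ with an edge between $j\neq j'$ iff $\bar D_jD_{j'}^T\ne0$ is connected. 3-division: it is 2-division and for all $j,j',j''$ the matrix $D_j^T\bar D_jD_{j''}^T\bar D_{j''}D_{j'}^T\bar D_{j'}D_j^T\bar D_j$ has at most one nonzero eigenvalue. $c$-division ($c\ge4$): it is $(c-1)$-division and ( * ) for every ordered collection $(j_1,\dots,j_c)$ of distinct indices, with $\{C\}=\{j_1,\dots,j_c\}$, and every $v\in\mathcal R(D_{j_1}^T)$ there is a row separation subspace $\mathcal S$ of the $\{C\}$-subset subproblem with $v\in\mathcal S$ and $\dim(\mathcal S\cap\mathcal R(D_{j_i}^T))=1$ for $i=1,\dots,c$. Loose $c$-division ($c\ge3$, $k\ge2$): it is 1-division; each $\bar D_jD_{j'}^T$ has exactly one singular value, meaning that it is a scalar multiple (possibly zero) of a unitary matrix (for nonzero ones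 this forces $r_j=r_{j'}$); ( * ) holds for $c$; and the graph on $\{1,\dots,k+1\}$ with an edge between $j\neq j'$ iff $\bar D_jD_{j'}^T\ne0$ is not connected. *)

theory Defs
  imports
    "Jordan_Normal_Form.DL_Rank"
    "Jordan_Normal_Form.Schur_Decomposition"
    "Jordan_Normal_Form.Spectral_Radius"
    "HOL-Combinatorics.Permutations"
begin

text \<open>
  The ground field is a parameter \<open>F :: complex set\<close>, which the theorem restricts to \<open>\<real>\<close> and
  \<open>UNIV\<close>. All matrices are complex matrices whose entries lie in \<open>F\<close>, so that eigenvalues are
  taken in the complex numbers over either field, and a unitary matrix with entries in \<open>\<real>\<close> is an
  orthogonal matrix. Column spaces and dimensions are those over \<open>F\<close>.
\<close>

definition fvec :: "complex set \<Rightarrow> nat \<Rightarrow> complex vec set" where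
  "fvec F n = {v \<in> carrier_vec n. set\<^sub>v v \<subseteq> F}"

definition fmat :: "complex set \<Rightarrow> nat \<Rightarrow> nat \<Rightarrow> complex mat set" where
  "fmat F m n = {A \<in> carrier_mat m n. elements_mat A \<subseteq> F}"

abbreviation cnj_mat :: "complex mat \<Rightarrow> complex mat" where
  "cnj_mat \<equiv> map_mat cnj"

definition col_space :: "complex set \<Rightarrow> complex mat \<Rightarrow> complex vec set" where
  "col_space F A = {A *\<^sub>v x | x. x \<in> fvec F (dim_col A)}"

abbreviation field_of :: "complex set \<Rightarrow> complex ring" where
  "field_of F \<equiv> class_ring \<lparr>carrier := F\<rparr>"

abbreviation vs_of :: "nat \<Rightarrow> complex vec set \<Rightarrow> (complex, complex vec) module" where
  "vs_of n S \<equiv> module_vec TYPE(complex) n \<lparr>carrier := S\<rparr>"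

text \<open>\<open>field_of F\<close> and \<open>vs_of n S\<close> do form a vector space over \<open>F\<close>, as the library
  dimension requires.\<close>

lemma field_of_field:
  assumes "F = \<real> \<or> F = UNIV"
  shows "field (field_of F)"
proof -
  have mem: "0 \<in> F" "1 \<in> F" "\<And>a b. a \<in> F \<Longrightarrow> b \<in> F \<Longrightarrow> a + b \<in> F"
     "\<And>a b. a \<in> F \<Longrightarrow> b \<in> F \<Longrightarrow> a * b \<in> F" "\<And>a. a \<in> F \<Longrightarrow> - a \<in> F" "\<And>a. a \<in> F \<Longrightarrow> inverse a \<in> F"
    using assms by auto
  have inv: "\<exists>b\<in>F. b * a = 1 \<and> a * b = 1" if "a \<in> F" "a \<noteq> 0" for a
    using mem(6) that by (intro bexI[of _ "inverse a"]) auto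
  have neg: "\<exists>b\<in>F. b + a = 0 \<and> a + b = 0" if "a \<in> F" for a
    using mem(5) that by (intro bexI[of _ "- a"]) auto
  show ?thesis
    by (unfold_locales; use mem inv neg in \<open>auto simp: class_ring_simps Units_def algebra_simps\<close>)
qed

lemma vectorspace_of:
  assumes F: "F = \<real> \<or> F = UNIV" and S: "S \<subseteq> carrier_vec n" "0\<^sub>v n \<in> S"
    "\<And>v w. v \<in> S \<Longrightarrow> w \<in> S \<Longrightarrow> v + w \<in> S" "\<And>a v. a \<in> F \<Longrightarrow> v \<in> S \<Longrightarrow> a \<cdot>\<^sub>v v \<in> S"
  shows "vectorspace (field_of F) (vs_of n S)"
proof -
  have m1: "-1 \<in> F" using F by auto
  have neg: "\<exists>w\<in>S. w + v = 0\<^sub>v n \<and> v + w = 0\<^sub>v n" if "v \<in> S" for v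
    proof (intro bexI[of _ "(-1) \<cdot>\<^sub>v v"] conjI)
    have "v \<in> carrier_vec n" using S(1) that by auto
    then show "(-1) \<cdot>\<^sub>v v + v = 0\<^sub>v n" "v + (-1) \<cdot>\<^sub>v v = 0\<^sub>v n" by (intro eq_vecI; auto)+
  qed (rule S(4)[OF m1 that])
  have c: "v \<in> carrier_vec n" if "v \<in> S" for v using that S(1) by auto
  interpret K: field "field_of F" by (rule field_of_field[OF F])
  have G: "abelian_group (vs_of n S)"
  proof (rule abelian_groupI, goal_cases)
    case (3 x y z) then show ?case using c by (auto simp: module_vec_def intro: assoc_add_vec)
  next case (4 x y) then show ?case using c by (auto simp: module_vec_def intro: comm_add_vec)
  next case (5 x) then show ?case using c by (auto simp: module_vec_def)
  next case (6 x) then show ?case using neg by (auto simp: module_vec_def)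
  qed (use S in \<open>auto simp: module_vec_def\<close>)
  have "Module.module (field_of F) (vs_of n S)"
  proof (rule Module.module.intro[OF K.is_cring G], unfold_locales, goal_cases)
    case (2 a b x) then show ?case using c by (auto simp: module_vec_def add_smult_distrib_vec)
  next case (3 a x y) then show ?case using c by (auto simp: module_vec_def intro: smult_add_distrib_vec)
  next case (4 a b x) then show ?case by (auto simp: module_vec_def smult_smult_assoc)
  next case (5 x) then show ?case using c by (auto simp: module_vec_def)
  qed (use S in \<open>auto simp: module_vec_def\<close>)
  then show ?thesis by (rule vectorspace.intro[OF _ K.field_axioms])
qed

definition fdim :: "complex set \<Rightarrow> nat \<Rightarrow> complex vec set \<Rightarrow> nat" where
  "fdim F n S = vectorspace.dim (field_of F) (vs_of n S)"

text \<open>The library rank is the one over the complex numbers; for a matrix with entries in \<open>F\<close> it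
  is also the rank over \<open>F\<close>.\<close>

definition mat_rank :: "complex mat \<Rightarrow> nat" where
  "mat_rank A = vec_space.rank (dim_row A) A"

definition unitary_mat :: "complex set \<Rightarrow> nat \<Rightarrow> complex mat \<Rightarrow> bool" where
  "unitary_mat F n U \<longleftrightarrow> U \<in> fmat F n n \<and> mat_adjoint U * U = 1\<^sub>m n"

definition permutation_matrix :: "nat \<Rightarrow> complex mat \<Rightarrow> bool" where
  "permutation_matrix n E \<longleftrightarrow>
    (\<exists>p. p permutes {..<n} \<and> E = mat n n (\<lambda>(i, j). if p i = j then 1 else 0))"


text \<open>
  A row separation problem in \<open>F\<close>-space of dimension \<open>d\<close> is a family of row blocks
  \<open>D j\<close>, \<open>j \<in> I\<close>, where \<open>r\<^sub>j = dim_row (D j)\<close>. The blocks are stacked in increasing order of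
  their indices. Keeping \<open>I\<close> as a parameter makes the \<open>C\<close>-subset subproblem the problem for
  \<open>C \<subseteq> I\<close> and the same \<open>D\<close>.
\<close>

definition row_separation_problem ::
  "complex set \<Rightarrow> nat \<Rightarrow> (nat \<Rightarrow> complex mat) \<Rightarrow> nat set \<Rightarrow> bool" where
  "row_separation_problem F d D I \<longleftrightarrow> finite I \<and>
    (\<forall>j\<in>I. D j \<in> fmat F (dim_row (D j)) d \<and> mat_rank (D j) = dim_row (D j))"

definition stack_rows :: "nat \<Rightarrow> complex mat list \<Rightarrow> complex mat" where
  "stack_rows d As = foldr (@\<^sub>r) As (0\<^sub>m 0 d)"

definition row_separation_solution ::
  "complex set \<Rightarrow> nat \<Rightarrow> (nat \<Rightarrow> complex mat) \<Rightarrow> nat set \<Rightarrow>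
   complex mat \<Rightarrow> (nat \<Rightarrow> complex mat) \<Rightarrow> complex mat \<Rightarrow> complex mat list \<Rightarrow> bool" where
  "row_separation_solution F d D I E H L Bs \<longleftrightarrow>
    permutation_matrix (\<Sum>j\<in>I. dim_row (D j)) E \<and>
    (\<forall>j\<in>I. unitary_mat F (dim_row (D j)) (H j)) \<and>
    unitary_mat F d L \<and>
    E * diag_block_mat (map H (sorted_list_of_set I))
      * stack_rows d (map D (sorted_list_of_set I)) * L = diag_block_mat Bs"

text \<open>The block row of \<open>diag_block_mat Bs\<close> containing \<open>Bs ! t\<close>.\<close>

definition block_row :: "complex mat list \<Rightarrow> nat \<Rightarrow> complex mat" where
  "block_row Bs t = mat (dim_row (Bs ! t)) (dim_col (diag_block_mat Bs))
    (\<lambda>(i, j). diag_block_mat Bs $$ (sum_list (map dim_row (take t Bs)) + i, j))"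

definition row_separation_subspace ::
  "complex set \<Rightarrow> nat \<Rightarrow> (nat \<Rightarrow> complex mat) \<Rightarrow> nat set \<Rightarrow> complex vec set \<Rightarrow> bool" where
  "row_separation_subspace F d D I S \<longleftrightarrow> S \<noteq> {0\<^sub>v d} \<and>
    (\<exists>E H L Bs t. row_separation_solution F d D I E H L Bs \<and> t < length Bs \<and>
      S = col_space F (cnj_mat L * (block_row Bs t)\<^sup>T))"


definition one_singular_value :: "complex set \<Rightarrow> complex mat \<Rightarrow> bool" where
  "one_singular_value F A \<longleftrightarrow> A = 0\<^sub>m (dim_row A) (dim_col A) \<or>
    (\<exists>a\<in>F. \<exists>U. unitary_mat F (dim_row A) U \<and> A = a \<cdot>\<^sub>m U)"

definition one_nonzero_eigenvalue_at_most :: "complex mat \<Rightarrow> bool" where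
  "one_nonzero_eigenvalue_at_most A \<longleftrightarrow> card (spectrum A - {0}) \<le> 1"

definition division_edges :: "(nat \<Rightarrow> complex mat) \<Rightarrow> nat set \<Rightarrow> (nat \<times> nat) set" where
  "division_edges D I = {(j, j'). j \<in> I \<and> j' \<in> I \<and> j \<noteq> j' \<and>
    cnj_mat (D j) * (D j')\<^sup>T \<noteq> 0\<^sub>m (dim_row (D j)) (dim_row (D j'))}"

text \<open>The edge relation is symmetric, because interchanging \<open>j\<close> and \<open>j'\<close> replaces the product by
  its conjugate transpose.\<close>

definition division_graph_connected :: "(nat \<Rightarrow> complex mat) \<Rightarrow> nat set \<Rightarrow> bool" where
  "division_graph_connected D I \<longleftrightarrow> (\<forall>j\<in>I. \<forall>j'\<in>I. (j, j') \<in> (division_edges D I)\<^sup>*)"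

definition gram :: "complex mat \<Rightarrow> complex mat" where
  "gram A = A\<^sup>T * cnj_mat A"

text \<open>\<open>cov D [j\<^sub>1, \<dots>, j\<^sub>c]\<close> is the product of the \<open>gram (D j\<^sub>i)\<close> in order, closed up by
  another factor \<open>gram (D j\<^sub>1)\<close>.\<close>

definition cov :: "(nat \<Rightarrow> complex mat) \<Rightarrow> nat list \<Rightarrow> complex mat" where
  "cov D js = foldr (\<lambda>j M. gram (D j) * M) js (gram (D (hd js)))"

definition collection_condition ::
  "complex set \<Rightarrow> nat \<Rightarrow> (nat \<Rightarrow> complex mat) \<Rightarrow> nat set \<Rightarrow> nat \<Rightarrow> bool" where
  "collection_condition F d D I c \<longleftrightarrow>
    (\<forall>js. length js = c \<and> distinct js \<and> set js \<subseteq> I \<longrightarrow>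
      (\<forall>v \<in> col_space F ((D (hd js))\<^sup>T).
        \<exists>S. row_separation_subspace F d D (set js) S \<and> v \<in> S \<and>
          (\<forall>j\<in>set js. fdim F d (S \<inter> col_space F ((D j)\<^sup>T)) = 1)))"

text \<open>\<open>division F d D I c\<close> says that the problem with blocks \<open>D j\<close>, \<open>j \<in> I\<close>, is a \<open>c\<close>-division problem. There is no notion of a \<open>0\<close>-division problem.\<close>

fun division ::
  "complex set \<Rightarrow> nat \<Rightarrow> (nat \<Rightarrow> complex mat) \<Rightarrow> nat set \<Rightarrow> nat \<Rightarrow> bool" where
  "division F d D I 0 \<longleftrightarrow> False"
| "division F d D I (Suc 0) \<longleftrightarrow>
    (\<forall>j\<in>I. card (spectrum (cnj_mat (D j) * (D j)\<^sup>T)) = 1 \<and> 2 \<le> mat_rank (D j))"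
| "division F d D I (Suc (Suc 0)) \<longleftrightarrow>
    division F d D I (Suc 0) \<and>
    (\<forall>j\<in>I. \<forall>j'\<in>I. one_singular_value F (cnj_mat (D j) * (D j')\<^sup>T)) \<and>
    division_graph_connected D I"
| "division F d D I (Suc (Suc (Suc 0))) \<longleftrightarrow>
    division F d D I (Suc (Suc 0)) \<and>
    (\<forall>j\<in>I. \<forall>j'\<in>I. \<forall>j''\<in>I. one_nonzero_eigenvalue_at_most
      (gram (D j) * gram (D j'') * gram (D j') * gram (D j)))"
| "division F d D I (Suc (Suc (Suc (Suc c)))) \<longleftrightarrow>
    division F d D I (Suc (Suc (Suc c))) \<and>
    collection_condition F d D I (Suc (Suc (Suc (Suc c))))"

definition loose_division ::
  "complex set \<Rightarrow> nat \<Rightarrow> (nat \<Rightarrow> complex mat) \<Rightarrow> nat set \<Rightarrow> nat \<Rightarrow> bool" where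
  "loose_division F d D I c \<longleftrightarrow> 3 \<le> c \<and> 3 \<le> card I \<and>
    division F d D I 1 \<and>
    (\<forall>j\<in>I. \<forall>j'\<in>I. one_singular_value F (cnj_mat (D j) * (D j')\<^sup>T)) \<and>
    collection_condition F d D I c \<and>
    \<not> division_graph_connected D I"

end

theory Submission
  imports Defs
begin

text \<open>
  Write \<open>V\<^sub>j\<close> for \<open>(D j)\<^sup>T\<close>, \<open>R\<^sub>j\<close> for its column space and \<open>P\<^sub>j\<close> for
  \<open>gram (D j)\<close>. In a 1-division problem \<open>P\<^sub>j\<close> is a nonzero multiple of the orthogonal
  projection onto \<open>R\<^sub>j\<close>, and the singular value condition says that projection from \<open>R\<^sub>i\<close> to
  \<open>R\<^sub>j\<close> is zero or a multiple of an isometry. A covariance matrix describes how a vector of \<open>R\<^sub>j\<close> returns to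
  \<open>R\<^sub>j\<close> after it has been projected around a cycle of blocks. As an endomorphism of
  \<open>R\<^sub>j\<close> this holonomy is zero or a multiple of a unitary map, hence normal, so the covariance matrix has at
  most one nonzero eigenvalue exactly when the cycle acts on \<open>R\<^sub>j\<close> as a scalar
  (\<open>cov_eigenvalue_iff_scalar_cycle\<close>).

  Row separation subspaces are tied to the maps \<open>P\<^sub>j\<close> as follows. A solution is a choice of
  orthogonal bases of all the \<open>R\<^sub>j\<close> whose vectors fall into mutually orthogonal groups, and a row
  separation subspace is the span of one group; so it is invariant under every \<open>P\<^sub>j\<close>
  (\<open>row_separation_subspace_invariant\<close>). Conversely every subspace \<open>S\<close> that is invariant under all
  \<open>P\<^sub>j\<close> contains the span of one group of a suitable solution, and this span still contains
  all \<open>P\<^sub>j S\<close>, so it is a row separation subspace unless every \<open>P\<^sub>j\<close> vanishes on \<open>S\<close>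
  (\<open>invariant_subspace_yields_row_separation\<close>).

  Suppose that the collection condition holds for \<open>c\<close> blocks. A vector \<open>v\<close> of \<open>R\<^sub>j\<close> lies in an
  invariant \<open>S\<close> that meets \<open>R\<^sub>j\<close> in a line, and a closed walk through these blocks maps that line
  to itself. So every \<open>v\<close> is an eigenvector of the closed walk, which is therefore a scalar
  (\<open>collection_condition_scalar_cycle\<close>).

  Suppose that all covariance matrices of full orderings have at most one nonzero eigenvalue. Cycles that miss some block
  are scalar by the hypothesis on \<open>k\<close>, so all simple cycles are scalar, and then so are all closed
  walks (\<open>all_scalar_if_distinct_scalar\<close>). Hence the line spanned by \<open>v\<close> can be transported to every
  block of its component of the graph independently of the path, and from arbitrary starting
  vectors to the blocks of the other components. This yields vectors \<open>u\<^sub>j\<close> of \<open>R\<^sub>j\<close>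
  such that \<open>P\<^sub>j\<close> maps \<open>u\<^sub>i\<close> to a multiple of \<open>u\<^sub>j\<close> (\<open>aligned_family\<close>). The subspace of
  all \<open>x\<close> such that each \<open>P\<^sub>j x\<close> is a multiple of \<open>u\<^sub>j\<close> is invariant, and the row separation
  subspace inside it meets each \<open>R\<^sub>j\<close> in the line of \<open>u\<^sub>j\<close>
  (\<open>collection_condition_if_all_scalar\<close>).

  For \<open>k \<ge> 3\<close> the two kinds of division problem differ only by the connectedness of the graph,
  which does not depend on \<open>k\<close>, so the left side of the equivalence amounts to the collection
  condition for \<open>k + 1\<close>. For \<open>k = 2\<close> it amounts to the eigenvalue condition on triples, in
  which the triples with a repeated block impose no condition, as their walks reduce to shorter ones.
\<close>

section \<open>Vectors, matrices and subspaces over the ground field\<close>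

locale ground_field =
  fixes F :: "complex set"
  assumes F_cases: "F = \<real> \<or> F = UNIV"
begin

lemma F_closed [simp, intro]:
  "0 \<in> F" "1 \<in> F" "of_real r \<in> F"
  "x \<in> F \<Longrightarrow> y \<in> F \<Longrightarrow> x + y \<in> F" "x \<in> F \<Longrightarrow> y \<in> F \<Longrightarrow> x - y \<in> F"
  "x \<in> F \<Longrightarrow> y \<in> F \<Longrightarrow> x * y \<in> F" "x \<in> F \<Longrightarrow> - x \<in> F"
  "x \<in> F \<Longrightarrow> inverse x \<in> F" "x \<in> F \<Longrightarrow> y \<in> F \<Longrightarrow> x / y \<in> F" "x \<in> F \<Longrightarrow> cnj x \<in> F"
  using F_cases by (auto simp: Reals_cnj_iff)

lemma F_sum [intro]: "(\<And>i. i \<in> A \<Longrightarrow> f i \<in> F) \<Longrightarrow> sum f A \<in> F"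
  by (induction A rule: infinite_finite_induct) auto

lemma fvec_iff: "v \<in> fvec F n \<longleftrightarrow> v \<in> carrier_vec n \<and> (\<forall>i<n. v $ i \<in> F)"
  unfolding fvec_def by (auto simp: vec_set_def)

lemma fmat_iff: "A \<in> fmat F m n \<longleftrightarrow> A \<in> carrier_mat m n \<and> (\<forall>i<m. \<forall>j<n. A $$ (i, j) \<in> F)"
proof -
  have "elements_mat A \<subseteq> F \<longleftrightarrow> (\<forall>i<m. \<forall>j<n. A $$ (i, j) \<in> F)" if "A \<in> carrier_mat m n"
  proof
    assume "elements_mat A \<subseteq> F"
    then show "\<forall>i<m. \<forall>j<n. A $$ (i, j) \<in> F" using elements_matI[OF that] by blast
  next
    assume "\<forall>i<m. \<forall>j<n. A $$ (i, j) \<in> F"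
    then show "elements_mat A \<subseteq> F" using that by (auto dest!: elements_matD)
  qed
  then show ?thesis unfolding fmat_def by auto
qed

lemma fvec_carrier: "v \<in> fvec F n \<Longrightarrow> v \<in> carrier_vec n"
  by (simp add: fvec_iff)

lemma fmat_carrier: "A \<in> fmat F m n \<Longrightarrow> A \<in> carrier_mat m n"
  by (simp add: fmat_iff)

lemma scalar_prod_F:
  assumes "v \<in> fvec F n" "w \<in> fvec F n" shows "v \<bullet> w \<in> F"
  using assms by (auto simp: fvec_iff scalar_prod_def)

lemma fvec_closed [simp, intro]:
  "0\<^sub>v n \<in> fvec F n"
  "v \<in> fvec F n \<Longrightarrow> w \<in> fvec F n \<Longrightarrow> v + w \<in> fvec F n"
  "v \<in> fvec F n \<Longrightarrow> w \<in> fvec F n \<Longrightarrow> v - w \<in> fvec F n"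
  "c \<in> F \<Longrightarrow> v \<in> fvec F n \<Longrightarrow> c \<cdot>\<^sub>v v \<in> fvec F n"
  "v \<in> fvec F n \<Longrightarrow> conjugate v \<in> fvec F n"
  "unit_vec n i \<in> fvec F n"
  by (auto simp: fvec_iff unit_vec_def)

lemma fmat_closed [simp, intro]:
  "1\<^sub>m n \<in> fmat F n n"
  "A \<in> fmat F m n \<Longrightarrow> A\<^sup>T \<in> fmat F n m"
  "A \<in> fmat F m n \<Longrightarrow> cnj_mat A \<in> fmat F m n"
  "c \<in> F \<Longrightarrow> A \<in> fmat F m n \<Longrightarrow> c \<cdot>\<^sub>m A \<in> fmat F m n"
  by (auto simp: fmat_iff)

lemma fmat_row_col:
  "A \<in> fmat F m n \<Longrightarrow> i < m \<Longrightarrow> row A i \<in> fvec F n"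
  "A \<in> fmat F m n \<Longrightarrow> i < n \<Longrightarrow> col A i \<in> fvec F m"
  by (auto simp: fmat_iff fvec_iff)

lemma fmat_mult [simp, intro]:
  assumes "A \<in> fmat F m n" "B \<in> fmat F n l" shows "A * B \<in> fmat F m l"
proof -
  have c: "A \<in> carrier_mat m n" "B \<in> carrier_mat n l" using assms by (auto simp: fmat_carrier)
  show ?thesis unfolding fmat_iff[of "A * B"]
    using c fmat_row_col(1)[OF assms(1)] fmat_row_col(2)[OF assms(2)] by (auto intro: scalar_prod_F)
qed

lemma fmat_mult_vec [simp, intro]:
  assumes "A \<in> fmat F m n" "v \<in> fvec F n" shows "A *\<^sub>v v \<in> fvec F m"
proof -
  have c: "A \<in> carrier_mat m n" using assms by (auto simp: fmat_carrier)
  show ?thesis unfolding fvec_iff[of "A *\<^sub>v v"]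
    using mult_mat_vec_carrier[OF c fvec_carrier[OF assms(2)]] c
      scalar_prod_F[OF fmat_row_col(1)[OF assms(1)] assms(2)] by simp
qed

end

definition (in ground_field) fsubspace :: "nat \<Rightarrow> complex vec set \<Rightarrow> bool" where
  "fsubspace n S \<longleftrightarrow> S \<subseteq> fvec F n \<and> 0\<^sub>v n \<in> S \<and>
    (\<forall>v\<in>S. \<forall>w\<in>S. v + w \<in> S) \<and> (\<forall>c\<in>F. \<forall>v\<in>S. c \<cdot>\<^sub>v v \<in> S)"

context ground_field
begin

lemma fsubspaceD:
  assumes "fsubspace n S"
  shows "v \<in> S \<Longrightarrow> v \<in> fvec F n" "v \<in> S \<Longrightarrow> v \<in> carrier_vec n" "0\<^sub>v n \<in> S"
    "v \<in> S \<Longrightarrow> w \<in> S \<Longrightarrow> v + w \<in> S" "c \<in> F \<Longrightarrow> v \<in> S \<Longrightarrow> c \<cdot>\<^sub>v v \<in> S"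
    "v \<in> S \<Longrightarrow> w \<in> S \<Longrightarrow> v - w \<in> S"
proof -
  show "v \<in> S \<Longrightarrow> w \<in> S \<Longrightarrow> v - w \<in> S"
  proof -
    assume vw: "v \<in> S" "w \<in> S"
    have c: "v \<in> carrier_vec n" "w \<in> carrier_vec n"
      using assms vw by (auto simp: fsubspace_def fvec_iff)
    have "(-1) \<cdot>\<^sub>v w \<in> S" using assms vw by (auto simp: fsubspace_def)
    then have "v + (-1) \<cdot>\<^sub>v w \<in> S" using assms vw by (auto simp: fsubspace_def)
    moreover have "v + (-1) \<cdot>\<^sub>v w = v - w" using c by auto
    ultimately show ?thesis by simp
  qed
qed (use assms in \<open>auto simp: fsubspace_def fvec_iff\<close>)

lemma fsubspace_fvec: "fsubspace n (fvec F n)"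
  by (auto simp: fsubspace_def)

lemma fsubspace_inter: "fsubspace n S \<Longrightarrow> fsubspace n T \<Longrightarrow> fsubspace n (S \<inter> T)"
  by (auto simp: fsubspace_def)

lemma fsubspace_col_space:
  assumes A: "A \<in> fmat F m n" shows "fsubspace m (col_space F A)"
proof -
  have Ac: "A \<in> carrier_mat m n" by (rule fmat_carrier[OF A])
  have 1: "A *\<^sub>v x + A *\<^sub>v y = A *\<^sub>v (x + y)" if "x \<in> fvec F n" "y \<in> fvec F n" for x y
    using that Ac by (simp add: mult_add_distrib_mat_vec[OF Ac] fvec_iff)
  have 2: "c \<cdot>\<^sub>v (A *\<^sub>v x) = A *\<^sub>v (c \<cdot>\<^sub>v x)" if "x \<in> fvec F n" for x c
    using that Ac by (simp add: mult_mat_vec[OF Ac] fvec_iff)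
  have 3: "0\<^sub>v m = A *\<^sub>v 0\<^sub>v n" using Ac by auto
  show ?thesis unfolding fsubspace_def col_space_def using A Ac 3 by (auto simp: 1 2)
qed

end

lemma cscalar_prod_sub_left:
  assumes "u \<in> carrier_vec n" "v \<in> carrier_vec n" "w \<in> carrier_vec n"
  shows "(u - v) \<bullet>c w = u \<bullet>c w - v \<bullet>c (w :: complex vec)"
  using assms by (simp add: minus_scalar_prod_distrib[of _ n])

lemma cscalar_prod_simps:
  assumes "u \<in> carrier_vec n" "v \<in> carrier_vec n" "w \<in> carrier_vec n"
  shows "(u + v) \<bullet>c w = u \<bullet>c w + v \<bullet>c (w :: complex vec)"
    "w \<bullet>c (u + v) = w \<bullet>c u + w \<bullet>c v"
    "w \<bullet>c (u - v) = w \<bullet>c u - w \<bullet>c v"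
    "(c \<cdot>\<^sub>v u) \<bullet>c w = c * (u \<bullet>c w)"
    "w \<bullet>c (c \<cdot>\<^sub>v u) = cnj c * (w \<bullet>c u)"
    "cnj (u \<bullet>c w) = w \<bullet>c u"
  using assms
  by (auto simp: scalar_prod_def sum.distrib sum_subtractf sum_distrib_left algebra_simps intro!: sum.cong)

lemma cscalar_prod_adjoint:
  assumes "A \<in> carrier_mat m n" "x \<in> carrier_vec n" "y \<in> carrier_vec m"
  shows "(A *\<^sub>v x) \<bullet>c y = x \<bullet>c (cnj_mat A\<^sup>T *\<^sub>v (y :: complex vec))"
proof -
  have "(A *\<^sub>v x) \<bullet>c y = (\<Sum>i<m. \<Sum>j<n. A $$ (i, j) * x $ j * cnj (y $ i))"
    using assms by (auto simp: scalar_prod_def sum_distrib_right atLeast0LessThan)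
  also have "\<dots> = (\<Sum>j<n. \<Sum>i<m. A $$ (i, j) * x $ j * cnj (y $ i))" by (rule sum.swap)
  also have "\<dots> = x \<bullet>c (cnj_mat A\<^sup>T *\<^sub>v y)"
    using assms by (auto simp: scalar_prod_def sum_distrib_left atLeast0LessThan algebra_simps intro!: sum.cong)
  finally show ?thesis .
qed


section \<open>Orthonormal bases adapted to a subspace\<close>

definition orthonormal_family :: "nat \<Rightarrow> (nat \<Rightarrow> complex vec) \<Rightarrow> bool" where
  "orthonormal_family m q \<longleftrightarrow> (\<forall>k<m. \<forall>l<m. q k \<bullet>c q l = (if k = l then 1 else 0))"

text \<open>The Gram--Schmidt residual: the component of \<open>x\<close> orthogonal to the first \<open>m\<close> vectors, provided
  that these are orthonormal.\<close>

primrec gs_residual :: "(nat \<Rightarrow> complex vec) \<Rightarrow> nat \<Rightarrow> complex vec \<Rightarrow> complex vec" where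
  "gs_residual q 0 x = x"
| "gs_residual q (Suc m) x = gs_residual q m x - (x \<bullet>c q m) \<cdot>\<^sub>v q m"

context ground_field
begin

lemma gs_residual_mem:
  assumes S: "fsubspace n S" "x \<in> S" and q: "\<forall>k<m. q k \<in> S"
  shows "gs_residual q m x \<in> S"
  using q
proof (induction m)
  case (Suc m)
  then have "q m \<in> S" by simp
  then have "(x \<bullet>c q m) \<in> F"
    using S by (auto intro!: scalar_prod_F dest: fsubspaceD)
  then show ?case using Suc S \<open>q m \<in> S\<close> by (auto intro!: fsubspaceD(5,6)[OF S(1)])
qed (use S in simp)

lemma gs_residual_orth:
  assumes q: "\<forall>k<M. q k \<in> fvec F n" "orthonormal_family M q" and x: "x \<in> fvec F n"
    and "m \<le> M" "l < M"
  shows "gs_residual q m x \<bullet>c q l = (if l < m then 0 else x \<bullet>c q l)"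
  using \<open>m \<le> M\<close>
proof (induction m)
  case (Suc m)
  have c: "q m \<in> carrier_vec n" "q l \<in> carrier_vec n" "gs_residual q m x \<in> carrier_vec n"
    using q(1) Suc(2) \<open>l < M\<close> gs_residual_mem[OF fsubspace_fvec x, of m q]
    by (auto simp: fvec_carrier)
  have "gs_residual q (Suc m) x \<bullet>c q l = gs_residual q m x \<bullet>c q l - (x \<bullet>c q m) * (q m \<bullet>c q l)"
    using c by (simp add: cscalar_prod_sub_left[of _ n] cscalar_prod_simps[of _ n])
  also have "\<dots> = (if l < Suc m then 0 else x \<bullet>c q l)"
    using Suc q(2) \<open>l < M\<close> by (cases "l = m") (auto simp: orthonormal_family_def)
  finally show ?case .
qed simp

text \<open>Bessel's identity, summed over the standard basis: the squared distances of the unit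
  vectors from the span of \<open>m\<close> orthonormal vectors add up to \<open>n - m\<close>. This bounds the size of an
  orthonormal family and shows that a family of fewer than \<open>n\<close> vectors leaves some residual,
  over either field and without any appeal to dimension theory.\<close>

lemma sum_gs_residual_norms:
  assumes q: "\<forall>k<m. q k \<in> fvec F n" "orthonormal_family m q"
  shows "(\<Sum>i<n. gs_residual q m (unit_vec n i) \<bullet>c gs_residual q m (unit_vec n i))
    = of_nat n - of_nat m"
  using q
proof (induction m)
  case 0
  have "unit_vec n i \<bullet>c unit_vec n i = (1::complex)" if "i < n" for i
    using that by (simp add: scalar_prod_left_unit)
  then show ?case by simp
next
  case (Suc m)
  define r where "r i = gs_residual q m (unit_vec n i)" for i
  have on: "orthonormal_family m q" using Suc by (auto simp: orthonormal_family_def)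
  have qc: "q m \<in> carrier_vec n" using Suc by (auto simp: fvec_carrier)
  have rc: "r i \<in> carrier_vec n" for i
    unfolding r_def using gs_residual_mem[OF fsubspace_fvec, of "unit_vec n i" n m q] Suc(2)
    by (auto simp: fvec_carrier)
  have qq: "q m \<bullet>c q m = 1" using Suc(3) by (auto simp: orthonormal_family_def)
  have rq: "r i \<bullet>c q m = cnj (q m $ i)" if "i < n" for i
    unfolding r_def using gs_residual_orth[OF Suc(2,3), of "unit_vec n i" m m] that qc
    by (simp add: scalar_prod_left_unit)
  have qr: "q m \<bullet>c r i = q m $ i" if "i < n" for i
    using cscalar_prod_simps(6)[OF rc[of i] qc qc] rq[OF that] by simp
  have uq: "unit_vec n i \<bullet>c q m = cnj (q m $ i)" if "i < n" for i
    using that qc by (simp add: scalar_prod_left_unit)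
  have step: "gs_residual q (Suc m) (unit_vec n i) \<bullet>c gs_residual q (Suc m) (unit_vec n i)
    = r i \<bullet>c r i - q m $ i * cnj (q m $ i)" if "i < n" for i
  proof -
    define w where "w = cnj (q m $ i) \<cdot>\<^sub>v q m"
    have wc: "w \<in> carrier_vec n" unfolding w_def using qc by simp
    have "gs_residual q (Suc m) (unit_vec n i) = r i - w"
      using uq[OF that] by (simp add: r_def w_def)
    then have "gs_residual q (Suc m) (unit_vec n i) \<bullet>c gs_residual q (Suc m) (unit_vec n i)
      = (r i - w) \<bullet>c (r i - w)" by simp
    also have "\<dots> = (r i \<bullet>c r i - r i \<bullet>c w) - (w \<bullet>c r i - w \<bullet>c w)"
      using rc[of i] wc by (simp add: cscalar_prod_sub_left[of _ n] cscalar_prod_simps(3)[of _ n])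
    also have "\<dots> = r i \<bullet>c r i - q m $ i * cnj (q m $ i)"
      unfolding w_def using rc[of i] qc rq[OF that] qr[OF that] qq
      by (simp add: cscalar_prod_simps(4,5)[of _ n])
    finally show ?thesis .
  qed
  have "(\<Sum>i<n. q m $ i * cnj (q m $ i)) = 1"
    using qq qc by (simp add: scalar_prod_def atLeast0LessThan)
  moreover have "(\<Sum>i<n. r i \<bullet>c r i) = of_nat n - of_nat m"
    using Suc(1)[OF _ on] Suc(2) unfolding r_def by simp
  ultimately show ?case by (simp add: step sum_subtractf del: gs_residual.simps)
qed

lemma orthonormal_family_bound:
  assumes "\<forall>k<m. q k \<in> fvec F n" "orthonormal_family m q"
  shows "m \<le> n"
proof -
  have "0 \<le> (\<Sum>i<n. gs_residual q m (unit_vec n i) \<bullet>c gs_residual q m (unit_vec n i))"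
    by (intro sum_nonneg conjugate_square_ge_0_vec)
  then have "0 \<le> Re (of_nat n - of_nat m)"
    unfolding sum_gs_residual_norms[OF assms] by (simp add: less_eq_complex_def)
  then show ?thesis by simp
qed

lemma orthonormal_family_extend:
  assumes S: "fsubspace n S" and q: "\<forall>k<m. q k \<in> S" "orthonormal_family m q"
  shows "\<exists>m' q'. m \<le> m' \<and> (\<forall>k<m. q' k = q k) \<and> (\<forall>k<m'. q' k \<in> S) \<and>
    orthonormal_family m' q' \<and> (\<forall>x\<in>S. gs_residual q' m' x = 0\<^sub>v n)"
  using q
proof (induction "n - m" arbitrary: m q rule: less_induct)
  case (less m q)
  have qF: "\<forall>k<m. q k \<in> fvec F n" using less.prems(1) fsubspaceD(1)[OF S] by auto
  show ?case
  proof (cases "\<forall>x\<in>S. gs_residual q m x = 0\<^sub>v n")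
    case True then show ?thesis using less.prems by (intro exI[of _ m] exI[of _ q]) auto
  next
    case False
    then obtain x where x: "x \<in> S" "gs_residual q m x \<noteq> 0\<^sub>v n" by blast
    define r where "r = gs_residual q m x"
    have rS: "r \<in> S" unfolding r_def by (rule gs_residual_mem[OF S x(1) less.prems(1)])
    have rc: "r \<in> carrier_vec n" by (rule fsubspaceD(2)[OF S rS])
    have pos: "r \<bullet>c r > 0" using x(2) rc unfolding r_def by simp
    (* a real factor, so that the normalized residual stays in S over either field *)
    define \<rho> where "\<rho> = complex_of_real (1 / sqrt (Re (r \<bullet>c r)))"
    have rho: "\<rho> * \<rho> * (r \<bullet>c r) = 1"
    proof -
      have re: "Re (r \<bullet>c r) > 0" "r \<bullet>c r = complex_of_real (Re (r \<bullet>c r))"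
        using pos by (auto simp: less_complex_def complex_eq_iff)
      have "\<rho> * \<rho> = complex_of_real (1 / Re (r \<bullet>c r))"
        unfolding \<rho>_def using re(1) by (simp flip: of_real_mult)
      then show ?thesis using re by (metis less_irrefl mult.commute nonzero_mult_div_cancel_left of_real_1 of_real_mult times_divide_eq_right mult_1_right)
    qed
    define q' where "q' = q(m := \<rho> \<cdot>\<^sub>v r)"
    have orth: "r \<bullet>c q k = 0" "q k \<bullet>c r = 0" if "k < m" for k
    proof -
      show 1: "r \<bullet>c q k = 0" unfolding r_def
        using gs_residual_orth[OF qF less.prems(2) _ order_refl that] fsubspaceD(1)[OF S x(1)] that
        by simp
      show "q k \<bullet>c r = 0"
        using cscalar_prod_simps(6)[OF rc rc, of "q k"] 1 qF that by (simp add: fvec_carrier)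
    qed
    have on: "orthonormal_family (Suc m) q'"
      unfolding orthonormal_family_def
    proof (intro allI impI)
      fix k l assume kl: "k < Suc m" "l < Suc m"
      have qkc: "q i \<in> carrier_vec n" if "i < m" for i using qF that by (auto simp: fvec_carrier)
      show "q' k \<bullet>c q' l = (if k = l then 1 else 0)"
        using kl rc qkc orth rho less.prems(2)
        by (cases "k = m"; cases "l = m")
          (auto simp: q'_def cscalar_prod_simps(4,5)[of _ n] orthonormal_family_def less_Suc_eq
            \<rho>_def simp flip: mult.assoc)
    qed
    have mem: "\<forall>k<Suc m. q' k \<in> S"
      using less.prems(1) rS fsubspaceD(5)[OF S _ rS, of \<rho>] by (auto simp: q'_def \<rho>_def less_Suc_eq)
    have "Suc m \<le> n"
      using orthonormal_family_bound[OF _ on] mem fsubspaceD(1)[OF S] by blast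
    then have "n - Suc m < n - m" by simp
    then obtain m' q'' where "Suc m \<le> m'" "\<forall>k<Suc m. q'' k = q' k" "\<forall>k<m'. q'' k \<in> S"
      "orthonormal_family m' q''" "\<forall>x\<in>S. gs_residual q'' m' x = 0\<^sub>v n"
      using less.hyps[OF _ mem on] by auto
    then show ?thesis
      by (intro exI[of _ m'] exI[of _ q'']) (auto simp: q'_def)
  qed
qed

text \<open>Extending the empty family inside \<open>S\<close> as far as possible, and then the result inside the
  whole space, gives a basis whose first \<open>s\<close> vectors span \<open>S\<close> and whose others are orthogonal
  to \<open>S\<close>.\<close>

lemma adapted_orthonormal_basis:
  assumes S: "fsubspace n S"
  shows "\<exists>q s. s \<le> n \<and> orthonormal_family n q \<and> (\<forall>k<n. q k \<in> fvec F n) \<and> (\<forall>k<s. q k \<in> S) \<and>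
    (\<forall>k. s \<le> k \<and> k < n \<longrightarrow> (\<forall>x\<in>S. x \<bullet>c q k = 0))"
proof -
  obtain s q where q: "\<forall>k<s. q k \<in> S" "orthonormal_family s q" "\<forall>x\<in>S. gs_residual q s x = 0\<^sub>v n"
    using orthonormal_family_extend[OF S, of 0 "\<lambda>_. 0\<^sub>v n"] by (auto simp: orthonormal_family_def)
  then have "\<forall>k<s. q k \<in> fvec F n" using fsubspaceD(1)[OF S] by blast
  from orthonormal_family_extend[OF fsubspace_fvec this q(2)]
  obtain m p where p: "s \<le> m" "\<forall>k<s. p k = q k" "\<forall>k<m. p k \<in> fvec F n" "orthonormal_family m p"
    "\<forall>x\<in>fvec F n. gs_residual p m x = 0\<^sub>v n" by blast
  have "of_nat n - of_nat m = (0::complex)"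
    unfolding sum_gs_residual_norms[OF p(3,4), symmetric] using p(5) by simp
  then have mn: "m = n" by simp
  have res: "gs_residual p s' x = gs_residual q s' x" if "s' \<le> s" for s' x
    using that by (induction s') (use p(2) in auto)
  have "x \<bullet>c p k = 0" if "s \<le> k" "k < n" "x \<in> S" for x k
  proof -
    have "gs_residual p s x \<bullet>c p k = (if k < s then 0 else x \<bullet>c p k)"
      using that p mn fsubspaceD(1)[OF S] by (intro gs_residual_orth[of m _ n]) auto
    then have "x \<bullet>c p k = 0\<^sub>v n \<bullet>c p k" using that q(3) by (simp add: res)
    also have "\<dots> = 0" using p(3) that mn by (auto simp: fvec_carrier)
    finally show ?thesis .
  qed
  then show ?thesis using p q mn by (intro exI[of _ p] exI[of _ s]) auto
qed

end

section \<open>Normal matrices with a single eigenvalue\<close>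

abbreviation adj :: "complex mat \<Rightarrow> complex mat" where
  "adj A \<equiv> cnj_mat (A\<^sup>T)"

lemma cnj_mat_mult:
  "A \<in> carrier_mat m n \<Longrightarrow> B \<in> carrier_mat n l \<Longrightarrow> cnj_mat (A * B) = cnj_mat A * cnj_mat B"
  by (intro eq_matI) (auto simp: scalar_prod_def)

lemma adj_mult:
  "A \<in> carrier_mat m n \<Longrightarrow> B \<in> carrier_mat n l \<Longrightarrow> adj (A * B) = adj B * adj A"
  by (simp add: transpose_mult[of A m n B l] cnj_mat_mult[of "B\<^sup>T" l n "A\<^sup>T" m])

lemma adj_adj [simp]: "adj (adj A) = A"
  by (intro eq_matI) auto

lemma mat_adjoint_eq_adj: "mat_adjoint A = adj A"
  by (intro eq_matI) (auto simp: mat_adjoint_def mat_of_rows_def cols_def)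

text \<open>For normal \<open>B\<close> the vectors \<open>B y\<close> and \<open>adj B y\<close> have equal length; with \<open>y = B x\<close> this
  makes \<open>adj B\<close> kill \<open>y\<close>, and then \<open>y\<close> is orthogonal to itself.\<close>

lemma normal_kernel_square:
  assumes B: "B \<in> carrier_mat n n" and normal: "B * adj B = adj B * B"
    and x: "x \<in> carrier_vec n" and BBx: "B *\<^sub>v (B *\<^sub>v x) = 0\<^sub>v n"
  shows "B *\<^sub>v x = 0\<^sub>v n"
proof -
  define y where "y = B *\<^sub>v x"
  have y: "y \<in> carrier_vec n" using B x unfolding y_def by simp
  have aB: "adj B \<in> carrier_mat n n" using B by simp
  have "(adj B *\<^sub>v y) \<bullet>c (adj B *\<^sub>v y) = y \<bullet>c (B *\<^sub>v (adj B *\<^sub>v y))"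
    using cscalar_prod_adjoint[OF aB y, of "adj B *\<^sub>v y"] aB y by simp
  also have "B *\<^sub>v (adj B *\<^sub>v y) = adj B *\<^sub>v (B *\<^sub>v y)"
    using normal assoc_mult_mat_vec[OF B aB y] assoc_mult_mat_vec[OF aB B y] by simp
  also have "\<dots> = 0\<^sub>v n" using BBx aB unfolding y_def by auto
  finally have "adj B *\<^sub>v y = 0\<^sub>v n"
    using conjugate_square_eq_0_vec[of "adj B *\<^sub>v y" n] mult_mat_vec_carrier[OF aB y] y by simp
  then have "y \<bullet>c y = 0" using cscalar_prod_adjoint[OF B x y] x by (simp add: y_def)
  then show ?thesis using y unfolding y_def by simp
qed

lemma mult_mat_vec_index_disjoint:
  assumes "M \<in> carrier_mat m n" "v \<in> carrier_vec n" "i < m"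
    and "\<And>l. l < n \<Longrightarrow> M $$ (i, l) = 0 \<or> v $ l = 0"
  shows "(M *\<^sub>v v) $ i = (0 :: complex)"
  using assms by (auto simp: scalar_prod_def intro!: sum.neutral)

text \<open>A triangularization \<open>A = P T Q\<close>, in which \<open>P\<close> need not be unitary, suffices: along its
  columns \<open>A - \<mu>\<close> is nilpotent, and a normal matrix with \<open>B\<^sup>2 x = 0\<close> has \<open>B x = 0\<close>.\<close>

lemma normal_single_eigenvalue:
  assumes A: "A \<in> carrier_mat n n" and normal: "A * adj A = adj A * A"
    and spec: "spectrum A \<subseteq> {\<mu>}"
  shows "A = \<mu> \<cdot>\<^sub>m 1\<^sub>m n"
proof -
  obtain es where es: "char_poly A = (\<Prod>a\<leftarrow>es. [:- a, 1:])"
    using char_poly_factorized[OF A] by blast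
  obtain T P Q where T: "schur_decomposition A es = (T, P, Q)"
    by (cases "schur_decomposition A es") auto
  from schur_decomposition[OF A es T] have sim: "similar_mat_wit A T P Q"
    and up: "upper_triangular T" and diag: "diag_mat T = es" by auto
  from similar_mat_witD2[OF A sim] have PQ: "P * Q = 1\<^sub>m n" "Q * P = 1\<^sub>m n" "A = P * T * Q"
    and c: "T \<in> carrier_mat n n" "P \<in> carrier_mat n n" "Q \<in> carrier_mat n n" by auto
  have Tii: "T $$ (i, i) = \<mu>" if "i < n" for i
  proof -
    have "T $$ (i, i) \<in> set es" using that c diag by (auto simp: diag_mat_def)
    then have "poly (char_poly A) (T $$ (i, i)) = 0"
      by (auto simp: es poly_prod_list prod_list_zero_iff o_def)
    then show ?thesis using spec spectrum_root_char_poly[OF A] by auto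
  qed
  define B where "B = A - \<mu> \<cdot>\<^sub>m 1\<^sub>m n"
  define N where "N = T - \<mu> \<cdot>\<^sub>m 1\<^sub>m n"
  have B: "B \<in> carrier_mat n n" and N: "N \<in> carrier_mat n n"
    using A c by (auto simp: B_def N_def)
  have BP: "B * P = P * N"
  proof -
    have "A * P = P * T" using c PQ by (simp add: assoc_mult_mat[of _ n n _ n _ n])
    moreover have "B * P = A * P - \<mu> \<cdot>\<^sub>m P" unfolding B_def
      using A c by (simp add: minus_mult_distrib_mat[of _ n n] mult_smult_assoc_mat[of _ n n])
    moreover have "P * N = P * T - \<mu> \<cdot>\<^sub>m P" unfolding N_def
      using A c by (simp add: mult_minus_distrib_mat[of _ n n] mult_smult_distrib[of P n n _ n])
    ultimately show ?thesis by simp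
  qed
  have normalB: "B * adj B = adj B * B"
  proof -
    have aA: "adj A \<in> carrier_mat n n" using A by simp
    have adjB: "adj B = adj A - cnj \<mu> \<cdot>\<^sub>m 1\<^sub>m n"
      unfolding B_def using A by (intro eq_matI) auto
    have shift: "(X - c \<cdot>\<^sub>m 1\<^sub>m n) * (Y - e \<cdot>\<^sub>m 1\<^sub>m n) = X * Y - (c \<cdot>\<^sub>m Y + e \<cdot>\<^sub>m X) + (c * e) \<cdot>\<^sub>m 1\<^sub>m n"
      if XY: "X \<in> carrier_mat n n" "Y \<in> carrier_mat n n" for X Y :: "complex mat" and c e
    proof -
      define Z where "Z = Y - e \<cdot>\<^sub>m 1\<^sub>m n"
      have Z: "Z \<in> carrier_mat n n" using XY by (auto simp: Z_def)
      have "(X - c \<cdot>\<^sub>m 1\<^sub>m n) * Z = X * Z - c \<cdot>\<^sub>m Z"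
        using Z by (simp add: minus_mult_distrib_mat[OF XY(1) _ Z] mult_smult_assoc_mat[of _ n n])
      also have "X * Z = X * Y - e \<cdot>\<^sub>m X" unfolding Z_def
        using XY by (simp add: mult_minus_distrib_mat[OF XY(1) XY(2)] mult_smult_distrib[of X n n _ n])
      finally show ?thesis using XY unfolding Z_def
        by (intro eq_matI) (auto simp: algebra_simps simp del: index_mult_mat(1))
    qed
    show ?thesis unfolding adjB unfolding B_def shift[OF A aA] shift[OF aA A] normal
      using A by (intro eq_matI) (auto simp: algebra_simps simp del: index_mult_mat(1))
  qed
  have BPc: "B * P \<in> carrier_mat n n" using B c by simp
  \<comment> \<open>column \<open>j\<close> of \<open>N\<close> is supported strictly above the diagonal, so \<open>B\<close> sends the \<open>j\<close>-th Schur
    vector into the span of the earlier ones, which \<open>B\<close> already kills\<close>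
  have "col (B * P) j = 0\<^sub>v n" if "j < n" for j
    using that
  proof (induction j rule: less_induct)
    case (less j)
    have pj: "col P j \<in> carrier_vec n" using c less by auto
    have Nj: "col N j \<in> carrier_vec n" using N less by auto
    have 1: "col (B * P) j = B *\<^sub>v col P j" by (rule col_mult2[OF B c(2) less(2)])
    have 2: "col (B * P) j = P *\<^sub>v col N j" unfolding BP by (rule col_mult2[OF c(2) N less(2)])
    have "B *\<^sub>v (B *\<^sub>v col P j) = B *\<^sub>v (P *\<^sub>v col N j)" using 1 2 by simp
    also have "\<dots> = (B * P) *\<^sub>v col N j"
      using assoc_mult_mat_vec[OF B c(2) Nj] by simp
    also have "\<dots> = 0\<^sub>v n"
    proof (intro eq_vecI)
      fix i assume i: "i < dim_vec (0\<^sub>v n :: complex vec)"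
      have "(B * P) $$ (i, l) * col N j $ l = 0" if "l < n" for l
      proof (cases "l < j")
        case True
        then have "col (B * P) l $ i = 0" using less i that by simp
        then have "(B * P) $$ (i, l) = 0"
          using B c i that index_col[of i "B * P" l] by (simp del: index_col index_mult_mat(1))
        then show ?thesis by (simp del: index_mult_mat(1))
      next
        case False
        then have "N $$ (l, j) = 0"
          using up c Tii[OF less(2)] that less(2) by (cases "l = j") (auto simp: N_def)
        then show ?thesis using N that less(2) by simp
      qed
      then show "((B * P) *\<^sub>v col N j) $ i = 0\<^sub>v n $ i"
        using i mult_mat_vec_index_disjoint[OF BPc Nj, of i] by simp
    qed (use B in simp)
    finally show ?case using 1 normal_kernel_square[OF B normalB pj] by simp
  qed
  then have "B * P = 0\<^sub>m n n" using BPc by (intro mat_col_eqI) auto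
  then have "B = 0\<^sub>m n n"
    using assoc_mult_mat[OF B c(2,3)] PQ B c by simp
  then have zero: "B $$ (i, j) = 0" if "i < n" "j < n" for i j using that by simp
  show ?thesis
  proof (rule eq_matI)
    fix i j assume ij: "i < dim_row (\<mu> \<cdot>\<^sub>m 1\<^sub>m n)" "j < dim_col (\<mu> \<cdot>\<^sub>m 1\<^sub>m n)"
    then show "A $$ (i, j) = (\<mu> \<cdot>\<^sub>m 1\<^sub>m n) $$ (i, j)"
      using zero[of i j] A by (simp add: B_def)
  qed (use A in auto)
qed

section \<open>Scaled unitary matrices\<close>

text \<open>Zero or a nonzero multiple of a unitary matrix, without reference to the ground field. The
  rectangular zero matrices are included in order that the class is closed under products.\<close>

definition conformal :: "complex mat \<Rightarrow> bool" where
  "conformal A \<longleftrightarrow> A = 0\<^sub>m (dim_row A) (dim_col A) \<or>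
    (\<exists>n c. c \<noteq> 0 \<and> A \<in> carrier_mat n n \<and> A * adj A = c \<cdot>\<^sub>m 1\<^sub>m n \<and> adj A * A = c \<cdot>\<^sub>m 1\<^sub>m n)"

lemma conformal_nonzero_cases:
  assumes "A \<in> carrier_mat m n" "conformal A" "A \<noteq> 0\<^sub>m m n"
  obtains c where "c \<noteq> 0" "m = n" "A * adj A = c \<cdot>\<^sub>m 1\<^sub>m n" "adj A * A = c \<cdot>\<^sub>m 1\<^sub>m n"
proof -
  obtain l c where c: "c \<noteq> 0" "A \<in> carrier_mat l l" "A * adj A = c \<cdot>\<^sub>m 1\<^sub>m l" "adj A * A = c \<cdot>\<^sub>m 1\<^sub>m l"
    using assms unfolding conformal_def by (metis carrier_matD)
  then have "l = m" "l = n" using assms(1) by auto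
  with c that show ?thesis by blast
qed

lemma smult_mat_mult_vec:
  assumes "A \<in> carrier_mat m n" "x \<in> carrier_vec n"
  shows "(c \<cdot>\<^sub>m A) *\<^sub>v x = c \<cdot>\<^sub>v (A *\<^sub>v (x :: complex vec))"
  using assms by (intro eq_vecI) auto

lemma conformal_one: "conformal (1\<^sub>m n)"
proof -
  have "adj (1\<^sub>m n) = 1\<^sub>m n" by (intro eq_matI) auto
  then show ?thesis unfolding conformal_def by (intro disjI2 exI[of _ n] exI[of _ 1]) (auto intro!: eq_matI)
qed

lemma conformal_mult:
  assumes A: "A \<in> carrier_mat m n" "conformal A" and B: "B \<in> carrier_mat n l" "conformal B"
  shows "conformal (A * B)"
proof (cases "A = 0\<^sub>m m n \<or> B = 0\<^sub>m n l")
  case True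
  then have "A * B = 0\<^sub>m m l" using A B by auto
  then show ?thesis unfolding conformal_def by simp
next
  case False
  obtain c where c: "c \<noteq> 0" "m = n" "A * adj A = c \<cdot>\<^sub>m 1\<^sub>m n" "adj A * A = c \<cdot>\<^sub>m 1\<^sub>m n"
    using conformal_nonzero_cases[OF A] False by metis
  obtain e where e: "e \<noteq> 0" "n = l" "B * adj B = e \<cdot>\<^sub>m 1\<^sub>m n" "adj B * B = e \<cdot>\<^sub>m 1\<^sub>m n"
    using conformal_nonzero_cases[OF B] False by metis
  have car: "A \<in> carrier_mat n n" "B \<in> carrier_mat n n" "adj A \<in> carrier_mat n n" "adj B \<in> carrier_mat n n"
    using A B c(2) e(2) by auto
  have 1: "X * (k \<cdot>\<^sub>m 1\<^sub>m n) * Y = k \<cdot>\<^sub>m (X * Y)"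
    if "X \<in> carrier_mat n n" "Y \<in> carrier_mat n n" for X Y :: "complex mat" and k
    using that by (simp add: mult_smult_distrib[of X n n _ n] mult_smult_assoc_mat[of X n n])
  have "(A * B) * adj (A * B) = A * (B * adj B) * adj A"
    using car by (simp add: adj_mult[of A n n] assoc_mult_mat[of _ n n _ n _ n])
  also have "\<dots> = (e * c) \<cdot>\<^sub>m 1\<^sub>m n"
    unfolding e(3) 1[OF car(1,3)] c(3) by (intro eq_matI) auto
  finally have l: "(A * B) * adj (A * B) = (e * c) \<cdot>\<^sub>m 1\<^sub>m n" .
  have "adj (A * B) * (A * B) = adj B * (adj A * A) * B"
    using car by (simp add: adj_mult[of A n n] assoc_mult_mat[of _ n n _ n _ n])
  also have "\<dots> = (e * c) \<cdot>\<^sub>m 1\<^sub>m n"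
    unfolding c(4) 1[OF car(4,2)] e(4) by (intro eq_matI) auto
  finally show ?thesis
    unfolding conformal_def using l car c(1) e(1)
    by (intro disjI2 exI[of _ n] exI[of _ "e * c"]) auto
qed

lemma (in ground_field) one_singular_value_conformal:
  assumes "one_singular_value F A"
  shows "conformal A"
proof (cases "A = 0\<^sub>m (dim_row A) (dim_col A)")
  case False
  define n where "n = dim_row A"
  obtain a U where a: "a \<in> F" "unitary_mat F n U" "A = a \<cdot>\<^sub>m U"
    using assms False unfolding one_singular_value_def n_def by auto
  then have U: "U \<in> carrier_mat n n" "adj U * U = 1\<^sub>m n"
    by (auto simp: unitary_mat_def fmat_carrier mat_adjoint_eq_adj)
  then have U': "U * adj U = 1\<^sub>m n"
    using mat_mult_left_right_inverse[of "adj U" n U] by simp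
  have a0: "a \<noteq> 0"
  proof
    assume "a = 0"
    then have "A = 0\<^sub>m (dim_row A) (dim_col A)" using a(3) by (intro eq_matI) auto
    with False show False by simp
  qed
  have adjA: "adj A = cnj a \<cdot>\<^sub>m adj U" using a(3) by (intro eq_matI) auto
  have 1: "(k \<cdot>\<^sub>m X) * (l \<cdot>\<^sub>m Y) = (k * l) \<cdot>\<^sub>m (X * Y)"
    if "X \<in> carrier_mat n n" "Y \<in> carrier_mat n n" for X Y :: "complex mat" and k l
    using that by (simp add: mult_smult_distrib[of _ n n _ n] mult_smult_assoc_mat[of X n n])
      (intro eq_matI, auto)
  have "A * adj A = (a * cnj a) \<cdot>\<^sub>m 1\<^sub>m n" "adj A * A = (a * cnj a) \<cdot>\<^sub>m 1\<^sub>m n"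
    unfolding adjA unfolding a(3) using U U' by (simp_all add: 1 mult.commute)
  then show ?thesis using a0 U(1) a(3) unfolding conformal_def
    by (intro disjI2 exI[of _ n] exI[of _ "a * cnj a"]) auto
qed (simp add: conformal_def)

text \<open>A nonzero conformal matrix is invertible, so all its eigenvalues are nonzero and the
  condition on the nonzero ones leaves a single eigenvalue.\<close>

lemma conformal_scalar:
  assumes M: "M \<in> carrier_mat n n" "conformal M" and spec: "card (spectrum M - {0}) \<le> 1"
  shows "\<exists>l. M = l \<cdot>\<^sub>m 1\<^sub>m n"
proof (cases "M = 0\<^sub>m n n")
  case True then show ?thesis by (intro exI[of _ 0] eq_matI) auto
next
  case False
  then obtain c where c: "c \<noteq> 0" "M * adj M = c \<cdot>\<^sub>m 1\<^sub>m n" "adj M * M = c \<cdot>\<^sub>m 1\<^sub>m n"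
    using conformal_nonzero_cases[OF M] by metis
  have "0 \<notin> spectrum M"
  proof
    assume "0 \<in> spectrum M"
    then obtain y where y: "y \<in> carrier_vec n" "y \<noteq> 0\<^sub>v n" "M *\<^sub>v y = 0 \<cdot>\<^sub>v y"
      using M by (auto simp: spectrum_def eigenvalue_def eigenvector_def)
    have "0 \<cdot>\<^sub>v y = 0\<^sub>v n" using y(1) by (intro eq_vecI) auto
    note y = y(1,2) y(3)[unfolded this]
    have "c \<cdot>\<^sub>v y = adj M *\<^sub>v (M *\<^sub>v y)"
      using y(1) M(1) c(3) assoc_mult_mat_vec[of "adj M" n n M n y] by (simp add: smult_mat_mult_vec[of _ n n])
    also have "\<dots> = 0\<^sub>v n" using y(3) M(1) by auto
    finally have "c * y $ i = 0" if "i < n" for i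
      using that y(1) by (metis carrier_vecD index_smult_vec(1) index_zero_vec(1))
    then have "y = 0\<^sub>v n" using c(1) y(1) by (intro eq_vecI) auto
    with y(2) show False by simp
  qed
  then have "card (spectrum M) \<le> 1" using spec by simp
  then have "\<forall>x\<in>spectrum M. \<forall>y\<in>spectrum M. x = y"
    using card_le_Suc0_iff_eq[OF card_finite_spectrum(1)[OF M(1)]] by simp
  then obtain \<mu> where "spectrum M \<subseteq> {\<mu>}" by blast
  then show ?thesis using normal_single_eigenvalue[OF M(1), of \<mu>] c by auto
qed

section \<open>Families of isoclinic subspaces\<close>

lemma mult_mat_zero_vec: "A \<in> carrier_mat m n \<Longrightarrow> A *\<^sub>v 0\<^sub>v n = (0\<^sub>v m :: complex vec)"
  by (intro eq_vecI) auto

lemma nonzero_vec_index: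
  assumes "v \<in> carrier_vec n" "v \<noteq> 0\<^sub>v n"
  obtains i where "i < n" "v $ i \<noteq> (0 :: complex)"
proof -
  have "\<exists>i<n. v $ i \<noteq> 0" using assms by (metis carrier_vecD eq_vecI index_zero_vec)
  with that show ?thesis by blast
qed

lemma (in ground_field) eigenvalue_in_F:
  assumes "x \<in> fvec F n" "x \<noteq> 0\<^sub>v n" "c \<cdot>\<^sub>v x \<in> fvec F n"
  shows "c \<in> F"
proof -
  obtain i where i: "i < n" "x $ i \<noteq> 0"
    using nonzero_vec_index[OF fvec_carrier[OF assms(1)] assms(2)] .
  have "c = (c \<cdot>\<^sub>v x) $ i / x $ i" using i assms(1) by (auto simp: fvec_iff)
  then show ?thesis using i assms by (metis F_closed(9) fvec_iff)
qed

text \<open>The conditions shared by all division problems from 2-division onwards and by loose ones: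
  the rows of each block are orthogonal of equal length, and any two row spaces are orthogonal or
  isoclinic. The numbers of rows form a parameter \<open>r\<close>, because a carrier fact that mentions
  \<open>dim_row (D j)\<close> itself would rewrite \<open>dim_row (D j)\<close> to itself.\<close>

locale isoclinic_family = ground_field F for F :: "complex set" +
  fixes d :: nat and r :: "nat \<Rightarrow> nat" and D :: "nat \<Rightarrow> complex mat" and I :: "nat set" and a :: "nat \<Rightarrow> complex"
  assumes finite_index: "finite I"
    and block: "j \<in> I \<Longrightarrow> D j \<in> fmat F (r j) d"
    and two_rows: "j \<in> I \<Longrightarrow> 2 \<le> r j"
    and scale: "j \<in> I \<Longrightarrow> a j \<in> F" "j \<in> I \<Longrightarrow> a j \<noteq> 0"
      "j \<in> I \<Longrightarrow> cnj_mat (D j) * (D j)\<^sup>T = a j \<cdot>\<^sub>m 1\<^sub>m (r j)"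
    and isoclinic: "i \<in> I \<Longrightarrow> j \<in> I \<Longrightarrow> one_singular_value F (cnj_mat (D i) * (D j)\<^sup>T)"
begin

abbreviation range_of :: "nat \<Rightarrow> complex vec set" where
  "range_of j \<equiv> col_space F ((D j)\<^sup>T)"

text \<open>Projection along a walk. The head of the list is the last block that is visited.\<close>

definition transport :: "nat list \<Rightarrow> complex vec \<Rightarrow> complex vec" where
  "transport js x = foldr (\<lambda>j. (*\<^sub>v) (gram (D j))) js x"

text \<open>The walk starts in the block \<open>hd js\<close>, passes through \<open>js\<close> from its end to its front and
  so returns to \<open>hd js\<close>. Since \<open>transport [hd js]\<close> already is a scalar on that block, the closing
  factor of the covariance matrix is left out.\<close>

definition scalar_cycle :: "nat list \<Rightarrow> bool" where
  "scalar_cycle js \<longleftrightarrow> (\<exists>c\<in>F. \<forall>x\<in>range_of (hd js). transport js x = c \<cdot>\<^sub>v x)"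

lemma transport_simps [simp]:
  "transport [] x = x"
  "transport (j # js) x = gram (D j) *\<^sub>v transport js x"
  "transport (js @ ks) x = transport js (transport ks x)"
  by (auto simp: transport_def)

lemma block_carrier:
  assumes "j \<in> I"
  shows "D j \<in> carrier_mat (r j) d" "(D j)\<^sup>T \<in> carrier_mat d (r j)"
    "cnj_mat (D j) \<in> carrier_mat (r j) d" "gram (D j) \<in> carrier_mat d d"
    "gram (D j) \<in> fmat F d d" "(D j)\<^sup>T \<in> fmat F d (r j)"
    "cnj_mat (D j) \<in> fmat F (r j) d"
proof -
  note D = block[OF assms]
  show "D j \<in> carrier_mat (r j) d" "(D j)\<^sup>T \<in> carrier_mat d (r j)"
    "cnj_mat (D j) \<in> carrier_mat (r j) d"
    using fmat_carrier[OF D] by auto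
  show "gram (D j) \<in> fmat F d d" unfolding gram_def using D by (intro fmat_mult fmat_closed)
  then show "gram (D j) \<in> carrier_mat d d" by (rule fmat_carrier)
  show "(D j)\<^sup>T \<in> fmat F d (r j)" "cnj_mat (D j) \<in> fmat F (r j) d"
    using D by (auto intro: fmat_closed)
qed

lemma fsubspace_range: "j \<in> I \<Longrightarrow> fsubspace d (range_of j)"
  by (rule fsubspace_col_space[OF block_carrier(6)])

lemma range_iff:
  assumes "j \<in> I"
  shows "x \<in> range_of j \<longleftrightarrow> (\<exists>y\<in>fvec F (r j). x = (D j)\<^sup>T *\<^sub>v y)"
  using block_carrier[OF assms] by (auto simp: col_space_def)

lemma gram_apply:
  assumes "j \<in> I" "x \<in> carrier_vec d"
  shows "gram (D j) *\<^sub>v x = (D j)\<^sup>T *\<^sub>v (cnj_mat (D j) *\<^sub>v x)"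
  unfolding gram_def using assms block_carrier(2,3)[OF assms(1)]
  by (intro assoc_mult_mat_vec) auto

lemma gram_in_range:
  assumes "j \<in> I" "x \<in> fvec F d"
  shows "gram (D j) *\<^sub>v x \<in> range_of j"
  using assms block_carrier(7)[OF assms(1)]
  by (auto simp: range_iff gram_apply fvec_carrier)

lemma coordinates_of_range:
  assumes "j \<in> I" "y \<in> carrier_vec (r j)"
  shows "cnj_mat (D j) *\<^sub>v ((D j)\<^sup>T *\<^sub>v y) = a j \<cdot>\<^sub>v y"
  using assms block_carrier(2,3)[OF assms(1)]
  by (simp add: assoc_mult_mat_vec[of _ _ d _ "r j", symmetric] scale(3)
      smult_mat_mult_vec[of _ "r j" "r j"])

lemma gram_range:
  assumes "j \<in> I" "x \<in> range_of j"
  shows "gram (D j) *\<^sub>v x = a j \<cdot>\<^sub>v x"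
proof -
  obtain y where y: "y \<in> carrier_vec (r j)" "x = (D j)\<^sup>T *\<^sub>v y"
    using assms range_iff fvec_carrier by blast
  then show ?thesis using assms block_carrier(2)[OF assms(1)]
    by (simp add: gram_apply coordinates_of_range mult_mat_vec)
qed

lemma range_carrier: "j \<in> I \<Longrightarrow> x \<in> range_of j \<Longrightarrow> x \<in> carrier_vec d"
  and range_fvec: "j \<in> I \<Longrightarrow> x \<in> range_of j \<Longrightarrow> x \<in> fvec F d"
  using fsubspaceD(1,2)[OF fsubspace_range] by auto

lemma gram_carrier_vec [simp]: "j \<in> I \<Longrightarrow> gram (D j) *\<^sub>v x \<in> carrier_vec d"
  using block_carrier(4) by (metis carrier_matD(1) carrier_vec_dim_vec dim_mult_mat_vec)

lemma transport_carrier: "set js \<subseteq> I \<Longrightarrow> x \<in> carrier_vec d \<Longrightarrow> transport js x \<in> carrier_vec d"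
  by (cases js) auto

lemma transport_fvec: "set js \<subseteq> I \<Longrightarrow> x \<in> fvec F d \<Longrightarrow> transport js x \<in> fvec F d"
  by (induction js) (auto intro!: fmat_mult_vec block_carrier(5))

lemma transport_smult:
  "set js \<subseteq> I \<Longrightarrow> x \<in> carrier_vec d \<Longrightarrow> transport js (c \<cdot>\<^sub>v x) = c \<cdot>\<^sub>v transport js x"
  by (induction js) (auto simp: mult_mat_vec[OF block_carrier(4)] transport_carrier)

lemma transport_add:
  "set js \<subseteq> I \<Longrightarrow> x \<in> carrier_vec d \<Longrightarrow> y \<in> carrier_vec d \<Longrightarrow>
    transport js (x + y) = transport js x + transport js y"
  by (induction js) (auto simp: mult_add_distrib_mat_vec[OF block_carrier(4)] transport_carrier)

lemma transport_zero: "set js \<subseteq> I \<Longrightarrow> transport js (0\<^sub>v d) = 0\<^sub>v d"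
  by (induction js) (auto simp: mult_mat_zero_vec[OF block_carrier(4)])

lemma transport_in_range:
  "js \<noteq> [] \<Longrightarrow> set js \<subseteq> I \<Longrightarrow> x \<in> fvec F d \<Longrightarrow> transport js x \<in> range_of (hd js)"
  by (cases js) (auto intro!: gram_in_range transport_fvec)

lemma range_nonzero:
  assumes "j \<in> I"
  shows "\<exists>x\<in>range_of j. x \<noteq> 0\<^sub>v d"
proof -
  define e :: "complex vec" where "e = unit_vec (r j) 0"
  have e: "e \<in> fvec F (r j)" "e $ 0 = 1" "e \<in> carrier_vec (r j)"
    using two_rows[OF assms] by (auto simp: e_def)
  have "cnj_mat (D j) *\<^sub>v 0\<^sub>v d = 0\<^sub>v (r j)"
    using block_carrier(3)[OF assms] by auto
  moreover have "a j \<cdot>\<^sub>v e \<noteq> 0\<^sub>v (r j)"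
  proof
    assume "a j \<cdot>\<^sub>v e = 0\<^sub>v (r j)"
    then have "(a j \<cdot>\<^sub>v e) $ 0 = 0" using two_rows[OF assms] by simp
    then show False using e two_rows[OF assms] scale(2)[OF assms] by simp
  qed
  ultimately have "(D j)\<^sup>T *\<^sub>v e \<noteq> 0\<^sub>v d"
    using coordinates_of_range[OF assms e(3)] by metis
  then show ?thesis using e(1) assms by (intro bexI[of _ "(D j)\<^sup>T *\<^sub>v e"]) (auto simp: range_iff)
qed

lemma cov_apply:
  assumes "js \<noteq> []" "set js \<subseteq> I" "x \<in> carrier_vec d"
  shows "cov D js *\<^sub>v x = transport js (gram (D (hd js)) *\<^sub>v x)"
    and cov_carrier: "cov D js \<in> carrier_mat d d"
proof -
  have "foldr (\<lambda>j M. gram (D j) * M) ks G \<in> carrier_mat d d \<and>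
      foldr (\<lambda>j M. gram (D j) * M) ks G *\<^sub>v x = transport ks (G *\<^sub>v x)"
    if "set ks \<subseteq> I" "G \<in> carrier_mat d d" for ks G
    using that(1)
  proof (induction ks)
    case (Cons j ks)
    then show ?case
      using assoc_mult_mat_vec[OF block_carrier(4)[of j] _ assms(3)] by (auto intro: mult_carrier_mat block_carrier(4))
  qed (use that in auto)
  from this[OF assms(2), of "gram (D (hd js))"]
  show "cov D js *\<^sub>v x = transport js (gram (D (hd js)) *\<^sub>v x)" "cov D js \<in> carrier_mat d d"
    using assms(2) block_carrier(4) hd_in_set[OF assms(1)] by (auto simp: cov_def)
qed

text \<open>Written as \<open>V V\<^sup>*\<close>, neighbouring factors of the covariance matrix combine to the conformal
  matrices \<open>V\<^sub>i\<^sup>* V\<^sub>j\<close>; their product is the middle factor.\<close>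

lemma cov_factorization:
  assumes "js \<noteq> []" "set js \<subseteq> I"
  shows "\<exists>M \<in> carrier_mat (r (hd js)) (r (hd js)). conformal M \<and>
    cov D js = (D (hd js))\<^sup>T * M * cnj_mat (D (hd js))"
proof -
  define h where "h = hd js"
  have h: "h \<in> I" using assms by (auto simp: h_def)
  (* the induction keeps the closing factor h fixed, so the empty list stands for the closing block alone *)
  have "\<exists>M \<in> carrier_mat (r (hd (ks @ [h]))) (r h). conformal M \<and>
    foldr (\<lambda>j M. gram (D j) * M) ks (gram (D h)) = (D (hd (ks @ [h])))\<^sup>T * M * cnj_mat (D h)"
    if "set ks \<subseteq> I" for ks
    using that
  proof (induction ks)
    case Nil
    show ?case using block_carrier(2,3)[OF h]
      by (intro bexI[of _ "1\<^sub>m (r h)"]) (auto simp: conformal_one gram_def)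
  next
    case (Cons j ks)
    define i where "i = hd (ks @ [h])"
    have ij: "i \<in> I" "j \<in> I" using Cons(2) h by (cases ks; auto simp: i_def)+
    obtain M where M: "M \<in> carrier_mat (r i) (r h)" "conformal M"
      "foldr (\<lambda>j M. gram (D j) * M) ks (gram (D h)) = (D i)\<^sup>T * M * cnj_mat (D h)"
      using Cons unfolding i_def by auto
    define A where "A = cnj_mat (D j) * (D i)\<^sup>T"
    have A: "A \<in> carrier_mat (r j) (r i)" "conformal A"
      using block_carrier(2)[OF ij(1)] block_carrier(3)[OF ij(2)]
        one_singular_value_conformal[OF isoclinic[OF ij(2,1)]] by (auto simp: A_def)
    note c = block_carrier(2,3)[OF ij(1)] block_carrier(2,3)[OF ij(2)] block_carrier(2,3)[OF h]
    let ?i = "r i" and ?j = "r j" and ?h = "r h"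
    have MW: "M * cnj_mat (D h) \<in> carrier_mat ?i d" using M(1) c by (intro mult_carrier_mat) auto
    have "(D j)\<^sup>T * cnj_mat (D j) * ((D i)\<^sup>T * M * cnj_mat (D h)) =
        (D j)\<^sup>T * (cnj_mat (D j) * ((D i)\<^sup>T * (M * cnj_mat (D h))))"
      using assoc_mult_mat[OF c(1) M(1) c(6)] assoc_mult_mat[OF c(3,4) mult_carrier_mat[OF c(1) MW]] by simp
    also have "\<dots> = (D j)\<^sup>T * (A * (M * cnj_mat (D h)))"
      unfolding A_def using assoc_mult_mat[OF c(4,1) MW] by simp
    also have "\<dots> = (D j)\<^sup>T * (A * M) * cnj_mat (D h)"
      using assoc_mult_mat[OF A(1) M(1) c(6)] assoc_mult_mat[OF c(3) mult_carrier_mat[OF A(1) M(1)] c(6)] by simp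
    finally have "gram (D j) * ((D i)\<^sup>T * M * cnj_mat (D h)) = (D j)\<^sup>T * (A * M) * cnj_mat (D h)"
      by (simp add: gram_def)
    then show ?case
      using A M conformal_mult[OF A M(1,2)] by (intro bexI[of _ "A * M"]) auto
  qed
  from this[OF assms(2)] show ?thesis using assms(1) by (simp add: cov_def h_def)
qed

text \<open>If \<open>M y = \<mu> y\<close>, then \<open>V y\<close> is an eigenvector of \<open>V M V\<^sup>*\<close> for \<open>a\<^sub>h \<mu>\<close>; so
  the conformal middle factor inherits the bound on the number of nonzero eigenvalues and is a
  scalar. In the other direction, an eigenvector for a nonzero eigenvalue lies in the complex
  column space of \<open>V\<close>, where the action is already known from the columns of \<open>V\<close>, which have
  entries in the ground field.\<close>

lemma cov_eigenvalue_iff_scalar_cycle: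
  assumes "js \<noteq> []" "set js \<subseteq> I"
  shows "one_nonzero_eigenvalue_at_most (cov D js) \<longleftrightarrow> scalar_cycle js"
proof
  define h where "h = hd js"
  let ?V = "(D h)\<^sup>T" and ?r = "r h"
  have h: "h \<in> I" using assms by (auto simp: h_def)
  obtain M where M: "M \<in> carrier_mat ?r ?r" "conformal M" "cov D js = ?V * M * cnj_mat (D h)"
    using cov_factorization[OF assms] unfolding h_def by blast
  note V = block_carrier(2,3)[OF h]
  note Kc = cov_carrier[OF assms, of "0\<^sub>v d", simplified]
  have Kx: "cov D js *\<^sub>v x = ?V *\<^sub>v (M *\<^sub>v (cnj_mat (D h) *\<^sub>v x))" if "x \<in> carrier_vec d" for x
    using that V M(1) assoc_mult_mat_vec[OF mult_carrier_mat[OF V(1) M(1)] V(2) that]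
      assoc_mult_mat_vec[OF V(1) M(1), of "cnj_mat (D h) *\<^sub>v x"] unfolding M(3)
    by (simp add: mult_mat_vec_carrier[OF V(2)])
  {
    assume ev: "one_nonzero_eigenvalue_at_most (cov D js)"
    have "a h * \<mu> \<in> spectrum (cov D js) - {0}" if mu: "\<mu> \<in> spectrum M - {0}" for \<mu>
    proof -
      obtain y where y: "y \<in> carrier_vec ?r" "y \<noteq> 0\<^sub>v ?r" "M *\<^sub>v y = \<mu> \<cdot>\<^sub>v y"
        using mu M(1) by (auto simp: spectrum_def eigenvalue_def eigenvector_def)
      define w where "w = ?V *\<^sub>v y"
      have w: "w \<in> carrier_vec d" using V y(1) by (auto simp: w_def)
      have "cov D js *\<^sub>v w = ?V *\<^sub>v (M *\<^sub>v (a h \<cdot>\<^sub>v y))"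
        using Kx[OF w] coordinates_of_range[OF h y(1)] by (simp add: w_def)
      also have "\<dots> = (a h * \<mu>) \<cdot>\<^sub>v w"
        using y V M(1) by (simp add: w_def mult_mat_vec[of _ ?r ?r] mult_mat_vec[of _ d ?r] smult_smult_assoc)
      finally have "cov D js *\<^sub>v w = (a h * \<mu>) \<cdot>\<^sub>v w" .
      moreover have "w \<noteq> 0\<^sub>v d"
      proof
        assume "w = 0\<^sub>v d"
        then have "a h \<cdot>\<^sub>v y = 0\<^sub>v ?r" using coordinates_of_range[OF h y(1)] mult_mat_zero_vec[OF V(2)] by (simp add: w_def)
        then have "a h * y $ i = 0" if "i < ?r" for i
          using that y(1) by (metis carrier_vecD index_smult_vec(1) index_zero_vec(1))
        then have "y = 0\<^sub>v ?r" using scale(2)[OF h] y(1) by (intro eq_vecI) auto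
        with y(2) show False by simp
      qed
      ultimately have "a h * \<mu> \<in> spectrum (cov D js)"
        using w Kc by (auto simp: spectrum_def eigenvalue_def eigenvector_def)
      then show ?thesis using mu scale(2)[OF h] by simp
    qed
    then have "card ((*) (a h) ` (spectrum M - {0})) \<le> card (spectrum (cov D js) - {0})"
      using card_finite_spectrum(1)[OF Kc] by (intro card_mono) auto
    also have "\<dots> \<le> 1" using ev by (simp add: one_nonzero_eigenvalue_at_most_def)
    finally have "card (spectrum M - {0}) \<le> 1"
      using scale(2)[OF h] by (subst (asm) card_image) (auto simp: inj_on_def)
    from conformal_scalar[OF M(1,2) this] obtain l where l: "M = l \<cdot>\<^sub>m 1\<^sub>m ?r" by blast
    have eig: "transport js x = l \<cdot>\<^sub>v x" if x: "x \<in> range_of h" for x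
    proof -
      obtain y where y: "y \<in> carrier_vec ?r" "x = ?V *\<^sub>v y"
        using x range_iff[OF h] fvec_carrier by blast
      have xc: "x \<in> carrier_vec d" by (rule range_carrier[OF h x])
      have "a h \<cdot>\<^sub>v transport js x = cov D js *\<^sub>v x"
        using cov_apply[OF assms xc] gram_range[OF h x] transport_smult[OF assms(2) xc] by (simp add: h_def)
      also have "\<dots> = a h \<cdot>\<^sub>v (l \<cdot>\<^sub>v x)"
        using Kx[OF xc] coordinates_of_range[OF h y(1)] V y
        by (simp add: l smult_mat_mult_vec[of _ ?r ?r] mult_mat_vec[of _ d ?r] smult_smult_assoc mult.commute)
      finally have "a h * transport js x $ i = a h * (l \<cdot>\<^sub>v x) $ i" if "i < d" for i
        using that xc transport_carrier[OF assms(2) xc] by (metis carrier_vecD index_smult_vec(1) smult_carrier_vec)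
      then show ?thesis using scale(2)[OF h] xc transport_carrier[OF assms(2) xc] by (intro eq_vecI) auto
    qed
    obtain x where x: "x \<in> range_of h" "x \<noteq> 0\<^sub>v d" using range_nonzero[OF h] by blast
    have "l \<in> F"
      using eigenvalue_in_F[OF range_fvec[OF h x(1)] x(2), of l]
        transport_fvec[OF assms(2) range_fvec[OF h x(1)]] eig[OF x(1)] by simp
    then show "scalar_cycle js" using eig by (auto simp: scalar_cycle_def h_def)
  next
    assume "scalar_cycle js"
    then obtain l where l: "\<And>x. x \<in> range_of h \<Longrightarrow> transport js x = l \<cdot>\<^sub>v x"
      by (auto simp: scalar_cycle_def h_def)
    have KV: "cov D js * ?V = (a h * l) \<cdot>\<^sub>m ?V"
    proof (rule mat_col_eqI)
      fix i assume "i < dim_col ((a h * l) \<cdot>\<^sub>m ?V)"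
      then have i: "i < ?r" using V by simp
      have x: "col ?V i \<in> range_of h"
        unfolding range_iff[OF h] using V(1) i
        by (intro bexI[of _ "unit_vec ?r i"]) (auto intro!: eq_vecI simp: scalar_prod_right_unit)
      have xc: "col ?V i \<in> carrier_vec d" by (rule range_carrier[OF h x])
      have "col (cov D js * ?V) i = cov D js *\<^sub>v col ?V i"
        using col_mult2[OF Kc V(1) i] by simp
      also have "\<dots> = (a h * l) \<cdot>\<^sub>v col ?V i"
        using cov_apply[OF assms xc] gram_range[OF h x] transport_smult[OF assms(2) xc] l[OF x]
        by (simp add: h_def smult_smult_assoc)
      finally show "col (cov D js * ?V) i = col ((a h * l) \<cdot>\<^sub>m ?V) i" using i V by simp
    qed (use Kc V in auto)
    have "\<mu> = a h * l" if mu: "\<mu> \<in> spectrum (cov D js)" "\<mu> \<noteq> 0" for \<mu>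
    proof -
      obtain w where w: "w \<in> carrier_vec d" "w \<noteq> 0\<^sub>v d" "cov D js *\<^sub>v w = \<mu> \<cdot>\<^sub>v w"
        using mu Kc by (auto simp: spectrum_def eigenvalue_def eigenvector_def)
      define y where "y = M *\<^sub>v (cnj_mat (D h) *\<^sub>v w)"
      have y: "y \<in> carrier_vec ?r" using M(1) V w by (auto simp: y_def)
      have Vy: "?V *\<^sub>v y = \<mu> \<cdot>\<^sub>v w" using Kx[OF w(1)] w(3) by (simp add: y_def)
      have "cov D js *\<^sub>v (?V *\<^sub>v y) = (a h * l) \<cdot>\<^sub>v (?V *\<^sub>v y)"
        using assoc_mult_mat_vec[OF Kc V(1) y] by (simp add: KV smult_mat_mult_vec[OF V(1) y])
      moreover have "cov D js *\<^sub>v (?V *\<^sub>v y) = \<mu> \<cdot>\<^sub>v (\<mu> \<cdot>\<^sub>v w)"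
        unfolding Vy using w Kc by (simp add: mult_mat_vec)
      ultimately have eq: "\<mu> \<cdot>\<^sub>v (\<mu> \<cdot>\<^sub>v w) = (a h * l) \<cdot>\<^sub>v (\<mu> \<cdot>\<^sub>v w)" unfolding Vy by simp
      obtain i where i: "i < d" "w $ i \<noteq> 0" using nonzero_vec_index[OF w(1,2)] .
      have "\<mu> * (\<mu> * w $ i) = (a h * l) * (\<mu> * w $ i)"
        using arg_cong[OF eq, of "\<lambda>v. v $ i"] i w(1) by simp
      then show ?thesis using i mu(2) by simp
    qed
    then have "spectrum (cov D js) - {0} \<subseteq> {a h * l}" by auto
    then have "card (spectrum (cov D js) - {0}) \<le> card {a h * l}" by (intro card_mono) auto
    then show "one_nonzero_eigenvalue_at_most (cov D js)" by (simp add: one_nonzero_eigenvalue_at_most_def)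
  }
qed

end

section \<open>Dimension one\<close>

context ground_field
begin

lemma mult_mat_vec_mem_fsubspace:
  assumes W: "fsubspace n W" and A: "A \<in> carrier_mat n m" and x: "x \<in> fvec F m"
    and cols: "\<And>k. k < m \<Longrightarrow> x $ k = 0 \<or> col A k \<in> W"
  shows "A *\<^sub>v x \<in> W"
proof -
  define p where "p l = vec n (\<lambda>i. \<Sum>k<l. A $$ (i, k) * x $ k)" for l
  have "p l \<in> W" if "l \<le> m" for l
    using that
  proof (induction l)
    case 0
    have "p 0 = 0\<^sub>v n" by (intro eq_vecI) (auto simp: p_def)
    then show ?case using fsubspaceD(3)[OF W] by simp
  next
    case (Suc l)
    have x: "x $ l \<in> F" using x Suc(2) by (auto simp: fvec_iff)
    show ?case
    proof (cases "x $ l = 0")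
      case True
      then have "p (Suc l) = p l" by (simp add: p_def)
      with Suc show ?thesis by simp
    next
      case False
      then have "col A l \<in> W" using cols[of l] Suc(2) by auto
      then have "p l + x $ l \<cdot>\<^sub>v col A l \<in> W"
        using Suc x by (intro fsubspaceD(4,5)[OF W]) auto
      moreover have "p (Suc l) = p l + x $ l \<cdot>\<^sub>v col A l"
        using A Suc(2) by (intro eq_vecI) (auto simp: p_def mult.commute)
      ultimately show ?thesis by simp
    qed
  qed
  moreover have "p m = A *\<^sub>v x"
    using A x by (intro eq_vecI) (auto simp: p_def scalar_prod_def fvec_iff atLeast0LessThan intro!: sum.cong)
  ultimately show ?thesis by force
qed

lemma col_mem_col_space:
  assumes "A \<in> fmat F n m" "k < m"
  shows "col A k \<in> col_space F A"
proof -
  have c: "A \<in> carrier_mat n m" by (rule fmat_carrier[OF assms(1)])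
  have "col A k = A *\<^sub>v unit_vec m k"
    using c assms(2) by (intro eq_vecI) (auto simp: scalar_prod_right_unit)
  then show ?thesis using c by (auto simp: col_space_def intro!: exI[of _ "unit_vec m k"])
qed

lemma fsubspace_vectorspace:
  assumes "fsubspace n S" shows "vectorspace (field_of F) (vs_of n S)"
  by (rule vectorspace_of[OF F_cases]) (use fsubspaceD[OF assms] in auto)

lemma fsubspace_line:
  assumes u: "u \<in> fvec F n" shows "fsubspace n {c \<cdot>\<^sub>v u | c. c \<in> F}"
proof -
  have uc: "u \<in> carrier_vec n" by (rule fvec_carrier[OF u])
  have "0\<^sub>v n = 0 \<cdot>\<^sub>v u" using uc by (intro eq_vecI) auto
  moreover have "c \<cdot>\<^sub>v u + e \<cdot>\<^sub>v u = (c + e) \<cdot>\<^sub>v u" for c e using uc by (simp add: add_smult_distrib_vec)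
  ultimately show ?thesis unfolding fsubspace_def using u
    by (auto simp: smult_smult_assoc)
qed

text \<open>The library span in \<open>vs_of n S\<close>, characterized by subspaces over \<open>F\<close>.\<close>

lemma fspan:
  assumes S: "fsubspace n S" and A: "A \<subseteq> S"
  defines "W \<equiv> LinearCombinations.module.span (field_of F) (vs_of n S) A"
  shows "fsubspace n W" "A \<subseteq> W" "W \<subseteq> S"
    "\<And>N. fsubspace n N \<Longrightarrow> A \<subseteq> N \<Longrightarrow> N \<subseteq> S \<Longrightarrow> W \<subseteq> N"
proof -
  interpret V: vectorspace "field_of F" "vs_of n S"
    by (rule fsubspace_vectorspace[OF S])
  have W: "W = V.span A" by (simp add: W_def)
  have AC: "A \<subseteq> carrier (vs_of n S)" using A by simp
  show "A \<subseteq> W" unfolding W by (rule V.in_own_span[OF AC])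
  show WS: "W \<subseteq> S" unfolding W using V.span_is_subset2[OF AC] by simp
  interpret W: submodule "field_of F" W "vs_of n S" unfolding W by (rule V.span_is_submodule[OF AC])
  show "fsubspace n W" unfolding fsubspace_def
    using W.m_closed W.zero_closed W.smult_closed WS S by (auto simp: module_vec_def fsubspace_def)
  show "W \<subseteq> N" if N: "fsubspace n N" "A \<subseteq> N" "N \<subseteq> S" for N
    unfolding W
  proof (rule V.span_is_subset[OF N(2)])
    show "submodule (field_of F) N (vs_of n S)"
      using V.module_axioms N by unfold_locales (auto simp: module_vec_def fsubspace_def)
  qed
qed

lemma fdim_eq_1I:
  assumes S: "fsubspace n S" and u: "u \<in> S" "u \<noteq> 0\<^sub>v n" and line: "\<And>y. y \<in> S \<Longrightarrow> \<exists>c\<in>F. y = c \<cdot>\<^sub>v u"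
  shows "fdim F n S = 1"
proof -
  interpret V: vectorspace "field_of F" "vs_of n S"
    by (rule fsubspace_vectorspace[OF S])
  have W: "fsubspace n (V.span {u})" "{u} \<subseteq> V.span {u}" "V.span {u} \<subseteq> S"
    using fspan[OF S, of "{u}"] u by auto
  have "S \<subseteq> V.span {u}"
  proof
    fix y assume "y \<in> S"
    then obtain c where "c \<in> F" "y = c \<cdot>\<^sub>v u" using line by blast
    then show "y \<in> V.span {u}" using W(2) fsubspaceD(5)[OF W(1)] by auto
  qed
  then have "V.gen_set {u}" using W(3) by simp
  then show ?thesis unfolding fdim_def
    by (rule V.dim1I) (use u in \<open>auto simp: module_vec_def\<close>)
qed

text \<open>Only a finitely generated space can be handled, since the library dimension of any other
  space is unspecified; the columns of a matrix provide the generators.\<close>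

lemma fdim_eq_1D:
  assumes A: "A \<in> fmat F n m" and dim: "fdim F n (col_space F A) = 1"
    and x: "x \<in> col_space F A" "x \<noteq> 0\<^sub>v n" and y: "y \<in> col_space F A"
  shows "\<exists>c\<in>F. y = c \<cdot>\<^sub>v x"
proof -
  define S where "S = col_space F A"
  have S: "fsubspace n S" unfolding S_def by (rule fsubspace_col_space[OF A])
  have Ac: "A \<in> carrier_mat n m" by (rule fmat_carrier[OF A])
  interpret V: vectorspace "field_of F" "vs_of n S"
    by (rule fsubspace_vectorspace[OF S])
  define C where "C = col A ` {..<m}"
  have C: "C \<subseteq> S" using col_mem_col_space[OF A] by (auto simp: C_def S_def)
  have "S \<subseteq> V.span C"
  proof
    fix z assume "z \<in> S"
    then obtain w where "w \<in> fvec F m" "z = A *\<^sub>v w" using Ac by (auto simp: S_def col_space_def)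
    then show "z \<in> V.span C"
      using fspan(1,2)[OF S C] by (auto intro!: mult_mat_vec_mem_fsubspace[of n _ A m] Ac simp: C_def)
  qed
  then have "V.gen_set C" using fspan(3)[OF S C] by auto
  \<comment> \<open>a dimension is only a minimum once some finite generating set is known\<close>
  then have "\<exists>k B. finite B \<and> card B = k \<and> B \<subseteq> carrier (vs_of n S) \<and> V.gen_set B"
    using C by (intro exI[of _ "card C"] exI[of _ C]) (auto simp: C_def)
  from LeastI_ex[OF this] obtain B where B: "card B = V.dim" "B \<subseteq> S" "V.gen_set B"
    unfolding V.dim_def by auto
  then obtain u where u: "B = {u}" using dim by (auto simp: fdim_def S_def card_1_singleton_iff)
  have uS: "u \<in> S" using B u by auto
  have uc: "u \<in> carrier_vec n" by (rule fsubspaceD(2)[OF S uS])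
  define N where "N = {c \<cdot>\<^sub>v u | c. c \<in> F}"
  have "fsubspace n N"
    unfolding N_def by (rule fsubspace_line[OF fsubspaceD(1)[OF S uS]])
  moreover have "u \<in> N" using uc by (auto simp: N_def intro!: exI[of _ 1])
  moreover have "N \<subseteq> S" using fsubspaceD(5)[OF S _ uS] by (auto simp: N_def)
  ultimately have "S \<subseteq> N" using fspan(4)[OF S, of B N] B u by auto
  then have "x \<in> N" "y \<in> N" using x(1) y by (auto simp: S_def)
  then obtain c e where ce: "c \<in> F" "x = c \<cdot>\<^sub>v u" "e \<in> F" "y = e \<cdot>\<^sub>v u"
    by (auto simp: N_def)
  have "0 \<cdot>\<^sub>v u = 0\<^sub>v n" using uc by (intro eq_vecI) auto
  then have "c \<noteq> 0" using x(2) ce(2) by auto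
  then have "y = (e / c) \<cdot>\<^sub>v x" using ce by (simp add: smult_smult_assoc)
  then show ?thesis using ce by blast
qed

end

section \<open>Row separation subspaces are invariant\<close>

lemma diag_block_mat_row_bound:
  "t < length Bs \<Longrightarrow> sum_list (map dim_row (take t Bs)) + dim_row (Bs ! t) \<le> dim_row (diag_block_mat Bs)"
  unfolding dim_diag_block_mat
  by (induction Bs arbitrary: t) (auto simp: nth_Cons take_Cons split: nat.splits)

lemma diag_block_mat_disjoint_rows:
  assumes "t < length Bs" "i < dim_row (diag_block_mat Bs)" "m < dim_col (diag_block_mat Bs)"
    and "i < sum_list (map dim_row (take t Bs)) \<or> sum_list (map dim_row (take t Bs)) + dim_row (Bs ! t) \<le> i"
  shows "diag_block_mat Bs $$ (i, m) = 0 \<or>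
    (\<forall>l<dim_row (Bs ! t). diag_block_mat Bs $$ (sum_list (map dim_row (take t Bs)) + l, m) = 0)"
  using assms
proof (induction Bs arbitrary: t i m)
  case (Cons B Bs)
  show ?case
  proof (cases t)
    case 0
    then show ?thesis using Cons.prems by (auto simp: Let_def)
  next
    case (Suc t')
    have bound: "sum_list (map dim_row (take t' Bs)) + dim_row (Bs ! t') \<le> dim_row (diag_block_mat Bs)"
      using Cons.prems(1) Suc by (intro diag_block_mat_row_bound) auto
    show ?thesis
    proof (cases "dim_row B \<le> i \<and> dim_col B \<le> m")
      case True
      then have "diag_block_mat Bs $$ (i - dim_row B, m - dim_col B) = 0 \<or>
        (\<forall>l<dim_row (Bs ! t'). diag_block_mat Bs $$ (sum_list (map dim_row (take t' Bs)) + l, m - dim_col B) = 0)"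
        using Cons.prems Suc by (intro Cons.IH) (auto simp: Let_def)
      then show ?thesis using True Cons.prems Suc bound by (auto simp: Let_def algebra_simps)
    next
      case False
      then show ?thesis using Cons.prems Suc bound by (auto simp: Let_def)
    qed
  qed
qed simp

lemma stack_rows_Cons: "stack_rows d (M # Ms) = M @\<^sub>r stack_rows d Ms"
  by (simp add: stack_rows_def)

lemma stack_rows_carrier:
  "\<forall>M\<in>set Ms. dim_col M = d \<Longrightarrow> stack_rows d Ms \<in> carrier_mat (sum_list (map dim_row Ms)) d"
  by (induction Ms) (auto simp: stack_rows_def intro!: carrier_append_rows)

lemma row_append_rows:
  assumes "A \<in> carrier_mat m d" "B \<in> carrier_mat n d" "i < m + n"
  shows "row (A @\<^sub>r B) i = (if i < m then row A i else row B (i - m))"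
  using assms by (intro eq_vecI) (auto simp: append_rows_def)

lemma rows_of_stack_rows:
  assumes "\<forall>M\<in>set Ms. dim_col M = d"
  shows "(\<exists>n<dim_row (stack_rows d Ms). v = row (stack_rows d Ms) n) \<longleftrightarrow>
    (\<exists>M\<in>set Ms. \<exists>i<dim_row M. v = row M i)"
  using assms
proof (induction Ms)
  case Nil then show ?case by (simp add: stack_rows_def)
next
  case (Cons M Ms)
  let ?m = "dim_row M" and ?n = "dim_row (stack_rows d Ms)"
  have c: "M \<in> carrier_mat ?m d" "stack_rows d Ms \<in> carrier_mat ?n d"
    using Cons.prems stack_rows_carrier[of Ms d] by auto
  have dim: "dim_row (stack_rows d (M # Ms)) = ?m + ?n"
    using carrier_append_rows[OF c] by (simp add: stack_rows_Cons)
  note row = row_append_rows[OF c]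
  have "(\<exists>n<?m + ?n. v = row (M @\<^sub>r stack_rows d Ms) n) \<longleftrightarrow>
    (\<exists>i<?m. v = row M i) \<or> (\<exists>n<?n. v = row (stack_rows d Ms) n)" (is "?L \<longleftrightarrow> ?R")
  proof
    assume ?L
    then obtain n where n: "n < ?m + ?n" "v = row (M @\<^sub>r stack_rows d Ms) n" by blast
    show ?R
    proof (cases "n < ?m")
      case True then show ?thesis using row[OF n(1)] n(2) by auto
    next
      case False
      then have "n - ?m < ?n" "v = row (stack_rows d Ms) (n - ?m)" using row[OF n(1)] n by auto
      then show ?thesis by blast
    qed
  next
    assume ?R
    then show ?L
    proof
      assume "\<exists>i<?m. v = row M i"
      then obtain i where "i < ?m" "v = row M i" by blast
      then show ?L using row[of i] by (intro exI[of _ i]) auto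
    next
      assume "\<exists>n<?n. v = row (stack_rows d Ms) n"
      then obtain i where "i < ?n" "v = row (stack_rows d Ms) i" by blast
      then show ?L using row[of "?m + i"] by (intro exI[of _ "?m + i"]) auto
    qed
  qed
  then show ?case using Cons by (simp add: dim[unfolded stack_rows_Cons] stack_rows_Cons)
qed

lemma diag_block_mat_mult_stack_rows:
  assumes "\<forall>j\<in>set js. H j \<in> carrier_mat (r j) (r j) \<and> D j \<in> carrier_mat (r j) d"
  shows "diag_block_mat (map H js) * stack_rows d (map D js) =
    stack_rows d (map (\<lambda>j. H j * (D j :: complex mat)) js)"
  using assms
proof (induction js)
  case Nil then show ?case by (auto simp: stack_rows_def)
next
  case (Cons j js)
  define X where "X = diag_block_mat (map H js)"
  define Y where "Y = stack_rows d (map D js)"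
  define N where "N = sum_list (map r js)"
  have dims: "map (\<lambda>x. dim_row (H x)) js = map r js" "map (\<lambda>x. dim_col (H x)) js = map r js"
    "map (\<lambda>x. dim_row (D x)) js = map r js"
    using Cons.prems by (induction js) auto
  have X: "X \<in> carrier_mat N N"
    by (rule carrier_matI) (simp_all add: X_def N_def dim_diag_block_mat dims o_def)
  have Y: "Y \<in> carrier_mat N d"
    using stack_rows_carrier[of "map D js" d] Cons.prems unfolding Y_def N_def by (auto simp: dims o_def)
  have Hj: "H j \<in> carrier_mat (r j) (r j)" "D j \<in> carrier_mat (r j) d" using Cons.prems by auto
  have "diag_block_mat (map H (j # js)) * stack_rows d (map D (j # js)) =
     four_block_mat (H j) (0\<^sub>m (r j) N) (0\<^sub>m N (r j)) X * four_block_mat (D j) (0\<^sub>m (r j) 0) Y (0\<^sub>m N 0)"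
    using X Y Hj by (simp add: stack_rows_Cons append_rows_def Let_def flip: X_def Y_def)
  also have "\<dots> = four_block_mat (H j * D j + 0\<^sub>m (r j) N * Y) (H j * 0\<^sub>m (r j) 0 + 0\<^sub>m (r j) N * 0\<^sub>m N 0)
      (0\<^sub>m N (r j) * D j + X * Y) (0\<^sub>m N (r j) * 0\<^sub>m (r j) 0 + X * 0\<^sub>m N 0)"
    using X Y Hj by (intro mult_four_block_mat) auto
  also have "\<dots> = (H j * D j) @\<^sub>r (X * Y)"
    using X Y Hj mult_carrier_mat[OF X Y] mult_carrier_mat[OF Hj]
    by (simp add: append_rows_def)
  also have "X * Y = stack_rows d (map (\<lambda>j. H j * D j) js)"
    using Cons unfolding X_def Y_def by simp
  finally show ?case by (simp add: stack_rows_Cons)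
qed

text \<open>Up to order, the rows of \<open>E * diag (H\<^sub>j) * D\<close> are the rows of all the \<open>H j * D j\<close>. Every
  argument about solutions below speaks of these rows only.\<close>

lemma stacked_product:
  fixes D H :: "nat \<Rightarrow> complex mat"
  assumes J: "finite J" and H: "\<And>j. j \<in> J \<Longrightarrow> H j \<in> carrier_mat (r j) (r j)"
    and D: "\<And>j. j \<in> J \<Longrightarrow> D j \<in> carrier_mat (r j) d"
  defines "js \<equiv> sorted_list_of_set J" and "N \<equiv> \<Sum>j\<in>J. dim_row (D j)"
  defines "X \<equiv> stack_rows d (map (\<lambda>j. H j * D j) js)"
  shows "X \<in> carrier_mat N d"
    "E \<in> carrier_mat N N \<Longrightarrow> E * diag_block_mat (map H js) * stack_rows d (map D js) = E * X"
    "(\<exists>n<N. v = row X n) \<longleftrightarrow> (\<exists>j\<in>J. \<exists>i<r j. v = row (H j * D j) i)"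
proof -
  have js: "set js = J" using J by (simp add: js_def)
  define G where "G j = H j * D j" for j
  have X_G: "X = stack_rows d (map G js)" by (simp add: X_def G_def[abs_def])
  have G: "dim_row (G j) = r j" "dim_col (G j) = d" if "j \<in> J" for j
    using H[OF that] D[OF that] by (auto simp: G_def)
  have "N = (\<Sum>j\<in>J. r j)" unfolding N_def by (intro sum.cong) (use D in auto)
  then have N: "N = sum_list (map r js)"
    unfolding js_def by (simp add: sum_list_distinct_conv_sum_set J)
  have dims: "map (\<lambda>j. dim_row (G j)) js = map r js" "map (\<lambda>j. dim_row (H j)) js = map r js"
    "map (\<lambda>j. dim_col (H j)) js = map r js" "map (\<lambda>j. dim_row (D j)) js = map r js"
    using G H D js by auto
  have G_cols: "\<forall>M\<in>set (map G js). dim_col M = d" and D_cols: "\<forall>M\<in>set (map D js). dim_col M = d"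
    using G(2) D js by auto
  show X: "X \<in> carrier_mat N d"
    using stack_rows_carrier[OF G_cols] unfolding X_G N by (simp only: map_map o_def dims)
  show "(\<exists>n<N. v = row X n) \<longleftrightarrow> (\<exists>j\<in>J. \<exists>i<r j. v = row (H j * D j) i)"
    using rows_of_stack_rows[OF G_cols, of v] X js G(1) by (simp add: X_G flip: G_def)
  assume E: "E \<in> carrier_mat N N"
  have "diag_block_mat (map H js) \<in> carrier_mat N N"
    by (intro carrier_matI) (simp_all only: dim_diag_block_mat N o_def map_map dims)
  moreover have "stack_rows d (map D js) \<in> carrier_mat N d"
    using stack_rows_carrier[OF D_cols] unfolding N by (simp only: map_map o_def dims)
  moreover have "diag_block_mat (map H js) * stack_rows d (map D js) = X"
    unfolding X_def using js D H by (intro diag_block_mat_mult_stack_rows[of _ _ r]) auto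
  ultimately show "E * diag_block_mat (map H js) * stack_rows d (map D js) = E * X"
    using assoc_mult_mat[OF E] by simp
qed

lemma permutation_matrix_mult:
  assumes E: "E = mat N N (\<lambda>(i, j). if p i = j then 1 else 0)" and p: "p permutes {..<N}"
    and X: "(X :: complex mat) \<in> carrier_mat N d" and i: "i < N"
  shows "row (E * X) i = row X (p i)"
proof (rule eq_vecI)
  fix m assume "m < dim_vec (row X (p i))"
  then have m: "m < d" using X by simp
  have pi: "p i < N" using permutes_in_image[OF p, of i] i by simp
  have "row (E * X) i $ m = (\<Sum>l<N. (if p i = l then 1 else 0) * X $$ (l, m))"
    using i m X by (auto simp: E scalar_prod_def atLeast0LessThan)
  also have "\<dots> = (\<Sum>l<N. if p i = l then X $$ (l, m) else 0)" by (intro sum.cong) auto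
  also have "\<dots> = X $$ (p i, m)" using pi by simp
  finally show "row (E * X) i $ m = row X (p i) $ m" using X pi m by simp
qed (use X in simp)


context ground_field
begin

lemma unitary_matD:
  assumes "unitary_mat F n U"
  shows "U \<in> fmat F n n" "U \<in> carrier_mat n n" "adj U * U = 1\<^sub>m n" "U * adj U = 1\<^sub>m n"
    "U\<^sup>T * cnj_mat U = 1\<^sub>m n" "cnj_mat U * U\<^sup>T = 1\<^sub>m n"
proof -
  have cnj1: "cnj_mat (1\<^sub>m n) = 1\<^sub>m n" by (intro eq_matI) auto
  have cc: "cnj_mat (cnj_mat A) = A" for A by (intro eq_matI) auto
  show U: "U \<in> fmat F n n" "adj U * U = 1\<^sub>m n"
    using assms by (auto simp: unitary_mat_def mat_adjoint_eq_adj)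
  show Uc: "U \<in> carrier_mat n n" by (rule fmat_carrier[OF U(1)])
  then show U': "U * adj U = 1\<^sub>m n"
    using mat_mult_left_right_inverse[of "adj U" n U] U(2) by simp
  show "U\<^sup>T * cnj_mat U = 1\<^sub>m n"
    using arg_cong[OF U(2), of cnj_mat] Uc by (simp add: cnj_mat_mult[of _ n n _ n] cnj1 cc)
  show "cnj_mat U * U\<^sup>T = 1\<^sub>m n"
    using arg_cong[OF U', of cnj_mat] Uc by (simp add: cnj_mat_mult[of _ n n _ n] cnj1 cc)
qed

lemma gram_unitary_mult:
  assumes H: "unitary_mat F m H" and A: "A \<in> carrier_mat m d"
  shows "gram (H * A) = gram A"
proof -
  note H = unitary_matD[OF H]
  have "gram (H * A) = (A\<^sup>T * H\<^sup>T) * (cnj_mat H * cnj_mat A)"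
    unfolding gram_def using H(2) A by (simp add: transpose_mult[of H m m A d] cnj_mat_mult[of H m m A d])
  also have "\<dots> = A\<^sup>T * ((H\<^sup>T * cnj_mat H) * cnj_mat A)"
    using H(2) A by (simp add: assoc_mult_mat[of _ d m _ m _ d] assoc_mult_mat[of _ m m _ m _ d])
  also have "\<dots> = gram A" unfolding H(5) gram_def using A by simp
  finally show ?thesis .
qed

text \<open>\<open>gram G *\<^sub>v s\<close> is the combination of the rows of \<open>G\<close> whose coefficients are the inner
  products of \<open>s\<close> with these rows, so a row orthogonal to \<open>s\<close> does not contribute.\<close>

lemma gram_mem_fsubspace:
  assumes G: "G \<in> fmat F m d" and S: "fsubspace d S" and s: "s \<in> fvec F d"
    and rows: "\<And>i. i < m \<Longrightarrow> row G i \<in> S \<or> s \<bullet>c row G i = 0"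
  shows "gram G *\<^sub>v s \<in> S"
proof -
  have Gc: "G \<in> carrier_mat m d" "s \<in> carrier_vec d" using G s by (auto simp: fmat_carrier fvec_carrier)
  have "gram G *\<^sub>v s = G\<^sup>T *\<^sub>v (cnj_mat G *\<^sub>v s)"
    unfolding gram_def using Gc by (intro assoc_mult_mat_vec) auto
  moreover have "G\<^sup>T *\<^sub>v (cnj_mat G *\<^sub>v s) \<in> S"
  proof (rule mult_mat_vec_mem_fsubspace[OF S, of _ m])
    show "cnj_mat G *\<^sub>v s \<in> fvec F m" using G s by (intro fmat_mult_vec) auto
    fix k assume k: "k < m"
    have "(cnj_mat G *\<^sub>v s) $ k = s \<bullet>c row G k"
      using k Gc by (auto simp: scalar_prod_def mult.commute)
    then show "(cnj_mat G *\<^sub>v s) $ k = 0 \<or> col (G\<^sup>T) k \<in> S" using rows[OF k] k Gc by auto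
  qed (use Gc in auto)
  ultimately show ?thesis by simp
qed

text \<open>After multiplication by \<open>L\<close>, rows in different diagonal blocks have disjoint supports.
  Hence each row of \<open>H j * D j\<close> lies in \<open>S\<close> or is orthogonal to \<open>S\<close>, and \<open>gram (D j)\<close>, which equals
  \<open>gram (H j * D j)\<close>, maps \<open>S\<close> to itself.\<close>

lemma row_separation_subspace_invariant:
  assumes J: "finite J" and D: "\<And>j. j \<in> J \<Longrightarrow> D j \<in> fmat F (r j) d"
    and S: "row_separation_subspace F d D J S"
  shows "\<exists>m. \<exists>B\<in>fmat F d m. S = col_space F B"
    and "j \<in> J \<Longrightarrow> s \<in> S \<Longrightarrow> gram (D j) *\<^sub>v s \<in> S"
proof -
  obtain E H L Bs t where sol: "row_separation_solution F d D J E H L Bs" "t < length Bs"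
    "S = col_space F (cnj_mat L * (block_row Bs t)\<^sup>T)"
    using S unfolding row_separation_subspace_def by blast
  define js where "js = sorted_list_of_set J"
  have js: "set js = J" using J by (simp add: js_def)
  have Dc: "D j \<in> carrier_mat (r j) d" "dim_row (D j) = r j" if "j \<in> J" for j
    using fmat_carrier[OF D[OF that]] by auto
  have H: "unitary_mat F (r j) (H j)" if "j \<in> J" for j
    using sol(1) that Dc by (auto simp: row_separation_solution_def)
  have L: "unitary_mat F d L" using sol(1) by (simp add: row_separation_solution_def)
  note L = L unitary_matD[OF L]
  define G where "G j = H j * D j" for j
  define X where "X = stack_rows d (map G js)"
  define N where "N = (\<Sum>j\<in>J. dim_row (D j))"
  define Y where "Y = diag_block_mat Bs"
  have GF: "G j \<in> fmat F (r j) d" if "j \<in> J" for j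
    unfolding G_def using unitary_matD(1)[OF H[OF that]] D[OF that] by (rule fmat_mult)
  have Hc: "H j \<in> carrier_mat (r j) (r j)" if "j \<in> J" for j by (rule unitary_matD(2)[OF H[OF that]])
  note stacked = stacked_product[of J H r D d, OF J, folded js_def G_def N_def]
  have X: "X \<in> carrier_mat N d" unfolding X_def by (rule stacked(1)[OF Hc Dc(1)])
  have X_rows: "(\<exists>n<N. v = row X n) \<longleftrightarrow> (\<exists>j\<in>J. \<exists>i<r j. v = row (G j) i)" for v
    unfolding X_def by (rule stacked(3)[OF Hc Dc(1)])
  obtain p where p: "p permutes {..<N}" "E = mat N N (\<lambda>(i, j). if p i = j then 1 else 0)"
    using sol(1) by (auto simp: row_separation_solution_def permutation_matrix_def N_def)
  have Ec: "E \<in> carrier_mat N N" by (simp add: p)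
  have "E * diag_block_mat (map H js) * stack_rows d (map D js) = E * X"
    unfolding X_def by (rule stacked(2)[OF Hc Dc(1) Ec])
  then have EXL: "E * X * L = Y"
    using sol(1) by (simp add: row_separation_solution_def js_def Y_def)
  have EX: "E * X \<in> carrier_mat N d" using Ec X by simp
  have Y: "Y \<in> carrier_mat N d" using mult_carrier_mat[OF EX L(3)] by (simp add: EXL)
  have "Y * adj L = E * X * (L * adj L)"
    unfolding EXL[symmetric] using EX L(3) by (intro assoc_mult_mat) auto
  then have YL: "Y * adj L = E * X" using L(5) right_mult_one_mat[OF EX] by simp
  \<comment> \<open>the rows of all \<open>G j\<close>, transposed, are \<open>cnj L\<close> times the rows of the block diagonal matrix\<close>
  have row_form: "\<exists>n<N. row (G j) i = cnj_mat L *\<^sub>v row Y n" if ji: "j \<in> J" "i < r j" for j i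
  proof -
    obtain n where n: "n < N" "row (G j) i = row X n" using X_rows[of "row (G j) i"] ji by blast
    obtain n' where n': "n' < N" "p n' = n"
      using n(1) permutes_surj[OF p(1)] permutes_in_image[OF p(1)] by (metis lessThan_iff surjD)
    have "row X n = row (Y * adj L) n'"
      using permutation_matrix_mult[OF p(2,1) X n'(1)] n'(2) YL by simp
    also have "\<dots> = cnj_mat L *\<^sub>v row Y n'"
      using n'(1) Y L(3) by (intro eq_vecI) (auto simp: scalar_prod_def mult.commute)
    finally show ?thesis using n n' by auto
  qed
  let ?B = "block_row Bs t" and ?o = "sum_list (map dim_row (take t Bs))" and ?b = "dim_row (Bs ! t)"
  define C where "C = cnj_mat L * ?B\<^sup>T"
  have YF: "Y \<in> fmat F N d"
  proof -
    have "E \<in> fmat F N N" unfolding p by (auto simp: fmat_iff)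
    moreover have "X \<in> fmat F N d"
    proof -
      have "row X n \<in> fvec F d" if n: "n < N" for n
      proof -
        obtain j i where "j \<in> J" "i < r j" "row X n = row (G j) i"
          using X_rows[of "row X n"] n by blast
        then show ?thesis using fmat_row_col(1)[OF GF] by simp
      qed
      then show ?thesis using X by (auto simp: fmat_iff fvec_iff)
    qed
    ultimately show ?thesis unfolding EXL[symmetric] using L(2) by (intro fmat_mult) auto
  qed
  have bound: "?o + ?b \<le> N" using diag_block_mat_row_bound[OF sol(2)] Y by (simp add: Y_def)
  have Bij: "?B $$ (l, m) = Y $$ (?o + l, m)" if "l < ?b" "m < d" for l m
    using YF bound Y that by (auto simp: block_row_def fmat_iff Y_def)
  have B: "?B \<in> fmat F ?b d"
    using YF bound Y by (auto simp: block_row_def fmat_iff Y_def)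
  have CF: "C \<in> fmat F d ?b" unfolding C_def using B L(2) by (intro fmat_mult) auto
  have SC: "S = col_space F C" using sol(3) by (simp add: C_def)
  then show "\<exists>m. \<exists>B\<in>fmat F d m. S = col_space F B" using CF by blast
  have subS: "fsubspace d S" unfolding SC by (rule fsubspace_col_space[OF CF])
  have Bc: "?B\<^sup>T \<in> carrier_mat d ?b" "cnj_mat L \<in> carrier_mat d d"
    using fmat_carrier[OF B] L(3) by auto
  have dichotomy: "cnj_mat L *\<^sub>v row Y n \<in> S \<or> s \<bullet>c (cnj_mat L *\<^sub>v row Y n) = 0"
    if n: "n < N" and s: "s \<in> S" for n s
  proof (cases "?o \<le> n \<and> n < ?o + ?b")
    case True
    then have "row Y n = col (?B\<^sup>T) (n - ?o)"
      using Bij[of "n - ?o"] Y n fmat_carrier[OF B] by (intro eq_vecI) auto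
    then have "cnj_mat L *\<^sub>v row Y n = col C (n - ?o)"
      unfolding C_def using True Bc by (subst col_mult2) auto
    then show ?thesis using col_mem_col_space[OF CF, of "n - ?o"] True SC by auto
  next
    case False
    obtain x where x: "x \<in> fvec F ?b" "s = C *\<^sub>v x"
      using s fmat_carrier[OF CF] by (auto simp: SC col_space_def)
    have xc: "x \<in> carrier_vec ?b" by (rule fvec_carrier[OF x(1)])
    define z where "z = ?B\<^sup>T *\<^sub>v x"
    have z: "z \<in> carrier_vec d" using Bc xc by (simp add: z_def)
    have rY: "row Y n \<in> carrier_vec d" using Y n by auto
    have "s = cnj_mat L *\<^sub>v z"
      unfolding x(2) C_def z_def using Bc xc by (intro assoc_mult_mat_vec) auto
    then have "s \<bullet>c (cnj_mat L *\<^sub>v row Y n) = z \<bullet>c (adj (cnj_mat L) *\<^sub>v (cnj_mat L *\<^sub>v row Y n))"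
      using cscalar_prod_adjoint[OF Bc(2) z, of "cnj_mat L *\<^sub>v row Y n"] Bc(2) rY by simp
    also have "adj (cnj_mat L) *\<^sub>v (cnj_mat L *\<^sub>v row Y n) = row Y n"
    proof -
      have "adj (cnj_mat L) = L\<^sup>T" by (intro eq_matI) auto
      then show ?thesis
        using assoc_mult_mat_vec[of "L\<^sup>T" d d "cnj_mat L" d "row Y n"] L rY by simp
    qed
    also have "z \<bullet>c row Y n = 0"
    proof -
      have "z $ m * cnj (Y $$ (n, m)) = 0" if m: "m < d" for m
      proof (cases "Y $$ (n, m) = 0")
        case False
        then have "\<forall>l<?b. Y $$ (?o + l, m) = 0"
          using diag_block_mat_disjoint_rows[OF sol(2), of n m] \<open>\<not> (?o \<le> n \<and> n < ?o + ?b)\<close> Y n m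
          by (auto simp: Y_def)
        then have "z $ m = 0"
          using Bij m Bc fmat_carrier[OF B] xc unfolding z_def
          by (auto simp: scalar_prod_def intro!: sum.neutral)
        then show ?thesis by simp
      qed simp
      then show ?thesis using z rY Y n by (auto simp: scalar_prod_def intro!: sum.neutral)
    qed
    finally show ?thesis by simp
  qed
  show "gram (D j) *\<^sub>v s \<in> S" if "j \<in> J" "s \<in> S" for j s
  proof -
    have "gram (G j) *\<^sub>v s \<in> S"
    proof (rule gram_mem_fsubspace[OF _ subS])
      show "G j \<in> fmat F (r j) d"
        by (rule GF[OF that(1)])
      show "row (G j) i \<in> S \<or> s \<bullet>c row (G j) i = 0" if "i < r j" for i
        using row_form[OF \<open>j \<in> J\<close> that] dichotomy[OF _ \<open>s \<in> S\<close>] by metis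
    qed (use fsubspaceD(1)[OF subS] that in auto)
    then show ?thesis using gram_unitary_mult[OF H Dc(1)] that by (simp add: G_def)
  qed
qed

end

section \<open>Closed walks act as scalars\<close>

context isoclinic_family
begin

text \<open>The scalar lies in the ground field automatically, because the walk maps vectors over the
  field to vectors over the field.\<close>

lemma scalar_cycleI:
  assumes "js \<noteq> []" "set js \<subseteq> I" and eig: "\<And>x. x \<in> range_of (hd js) \<Longrightarrow> transport js x = c \<cdot>\<^sub>v x"
  shows "scalar_cycle js"
proof -
  have h: "hd js \<in> I" using assms(1,2) by auto
  obtain x where x: "x \<in> range_of (hd js)" "x \<noteq> 0\<^sub>v d" using range_nonzero[OF h] by blast
  have "c \<in> F"
    using eigenvalue_in_F[OF range_fvec[OF h x(1)] x(2)] eig[OF x(1)]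
      transport_fvec[OF assms(2) range_fvec[OF h x(1)]] by simp
  then show ?thesis using eig by (auto simp: scalar_cycle_def)
qed

text \<open>The usual comparison of \<open>x\<close>, \<open>y\<close> and \<open>x + y\<close>: eigenvectors for different eigenvalues
  have no eigenvector as their sum.\<close>

lemma scalar_cycle_if_all_eigenvectors:
  assumes js: "js \<noteq> []" "set js \<subseteq> I"
    and eig: "\<And>x. x \<in> range_of (hd js) \<Longrightarrow> \<exists>c\<in>F. transport js x = c \<cdot>\<^sub>v x"
  shows "scalar_cycle js"
proof -
  have h: "hd js \<in> I" using js by auto
  obtain x where x: "x \<in> range_of (hd js)" "x \<noteq> 0\<^sub>v d" using range_nonzero[OF h] by blast
  obtain c where c: "c \<in> F" "transport js x = c \<cdot>\<^sub>v x" using eig[OF x(1)] by blast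
  have xc: "x \<in> carrier_vec d" by (rule range_carrier[OF h x(1)])
  have "transport js y = c \<cdot>\<^sub>v y" if y: "y \<in> range_of (hd js)" for y
  proof -
    have yc: "y \<in> carrier_vec d" by (rule range_carrier[OF h y])
    obtain e where e: "transport js y = e \<cdot>\<^sub>v y" using eig[OF y] by blast
    have "x + y \<in> range_of (hd js)" using fsubspaceD(4)[OF fsubspace_range[OF h] x(1) y] .
    then obtain f where "transport js (x + y) = f \<cdot>\<^sub>v (x + y)" using eig by blast
    then have comb: "c \<cdot>\<^sub>v x + e \<cdot>\<^sub>v y = f \<cdot>\<^sub>v (x + y)" using transport_add[OF js(2) xc yc] c e by simp
    have eq: "(c - f) * x $ i = (f - e) * y $ i" if "i < d" for i
    proof -
      have "c * x $ i + e * y $ i = f * (x $ i + y $ i)"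
        using that xc yc arg_cong[OF comb, of "\<lambda>v. v $ i"] by simp
      then show ?thesis by (simp add: algebra_simps)
    qed
    show ?thesis
    proof (cases "f = e")
      case True
      obtain i where i: "i < d" "x $ i \<noteq> 0" using nonzero_vec_index[OF xc x(2)] .
      then have "c = f" using eq[OF i(1)] True by simp
      then show ?thesis using e True by simp
    next
      case False
      define k where "k = (c - f) / (f - e)"
      have "y = k \<cdot>\<^sub>v x"
      proof (rule eq_vecI)
        fix i assume "i < dim_vec (k \<cdot>\<^sub>v x)"
        then show "y $ i = (k \<cdot>\<^sub>v x) $ i"
          using eq[of i] xc False by (simp add: k_def field_simps)
      qed (use xc yc in simp)
      then show ?thesis using c xc transport_smult[OF js(2) xc] by (simp add: smult_smult_assoc mult.commute)
    qed
  qed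
  then show ?thesis using c by (auto simp: scalar_cycle_def)
qed

text \<open>For \<open>v\<close> in the block \<open>h\<close>, the subspace \<open>S\<close> from the collection condition is invariant,
  so the closed walk maps the line of \<open>S\<close> in the block \<open>h\<close> to itself. This applies to every
  walk inside a collection of \<open>c\<close> blocks, also to one that omits or repeats some of them, and so
  the condition for \<open>k\<close> controls all cycles shorter than \<open>k + 1\<close>.\<close>

lemma collection_condition_scalar_cycle:
  assumes coll: "collection_condition F d D I c"
    and js: "js \<noteq> []" "set js \<subseteq> J" and J: "J \<subseteq> I" "card J = c"
  shows "scalar_cycle js"
proof (rule scalar_cycle_if_all_eigenvectors)
  show "set js \<subseteq> I" using js J by auto
  fix x assume x: "x \<in> range_of (hd js)"
  define h where "h = hd js"
  have hJ: "h \<in> J" unfolding h_def using js(2) hd_in_set[OF js(1)] by blast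
  then have h: "h \<in> I" using J by blast
  have fJ: "finite J" using J finite_index by (auto dest: finite_subset)
  (* an ordering of the whole collection that starts with the first block of the walk *)
  define ks where "ks = h # sorted_list_of_set (J - {h})"
  have ks: "set ks = J" "distinct ks" "hd ks = h" using fJ hJ by (auto simp: ks_def)
  then have len: "length ks = c" using J distinct_card by fastforce
  have "\<exists>S. row_separation_subspace F d D (set ks) S \<and> x \<in> S \<and>
      (\<forall>j\<in>set ks. fdim F d (S \<inter> col_space F ((D j)\<^sup>T)) = 1)"
    using coll ks len J x unfolding collection_condition_def h_def by auto
  then obtain S where S: "row_separation_subspace F d D J S" "x \<in> S"
    and dim: "\<And>j. j \<in> J \<Longrightarrow> fdim F d (S \<inter> range_of j) = 1" unfolding ks(1) by auto
  have DJ: "\<And>j. j \<in> J \<Longrightarrow> D j \<in> fmat F (r j) d" using J block by auto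
  obtain m B where B: "B \<in> fmat F d m" "S = col_space F B"
    using row_separation_subspace_invariant(1)[OF fJ DJ S(1)] by auto
  have inv: "gram (D j) *\<^sub>v s \<in> S" if "j \<in> J" "s \<in> S" for j s
    using row_separation_subspace_invariant(2)[OF fJ DJ S(1)] that by auto
  have Bc: "B \<in> carrier_mat d m" by (rule fmat_carrier[OF B(1)])
  have subS: "fsubspace d S" unfolding B(2) by (rule fsubspace_col_space[OF B(1)])
  define C where "C = gram (D h) * B"
  have C: "C \<in> fmat F d m" unfolding C_def using block_carrier(5)[OF h] B(1) by (rule fmat_mult)
  have Cw: "C *\<^sub>v w = gram (D h) *\<^sub>v (B *\<^sub>v w)" if "w \<in> carrier_vec m" for w
    unfolding C_def by (rule assoc_mult_mat_vec[OF block_carrier(4)[OF h] Bc that])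
  have line: "S \<inter> range_of h = col_space F C"
  proof (intro equalityI subsetI)
    fix y assume y: "y \<in> S \<inter> range_of h"
    then obtain w where w: "w \<in> fvec F m" "y = B *\<^sub>v w" using B Bc by (auto simp: col_space_def)
    have wc: "w \<in> carrier_vec m" by (rule fvec_carrier[OF w(1)])
    have yc: "y \<in> carrier_vec d" using y range_carrier[OF h] by auto
    have "C *\<^sub>v (inverse (a h) \<cdot>\<^sub>v w) = inverse (a h) \<cdot>\<^sub>v (gram (D h) *\<^sub>v y)"
      using wc fmat_carrier[OF C] Cw[OF wc] w(2) by (simp add: mult_mat_vec)
    also have "\<dots> = y" using gram_range[OF h, of y] y scale(2)[OF h] yc by (simp add: smult_smult_assoc)
    finally show "y \<in> col_space F C"
      using w(1) scale(1)[OF h] fmat_carrier[OF C]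
      by (auto simp: col_space_def intro!: exI[of _ "inverse (a h) \<cdot>\<^sub>v w"])
  next
    fix y assume "y \<in> col_space F C"
    then obtain w where w: "w \<in> fvec F m" "y = gram (D h) *\<^sub>v (B *\<^sub>v w)"
      using fmat_carrier[OF C] Cw fvec_carrier by (auto simp: col_space_def)
    then have "B *\<^sub>v w \<in> S" using Bc B by (auto simp: col_space_def)
    then show "y \<in> S \<inter> range_of h"
      using inv[OF hJ] gram_in_range[OF h fsubspaceD(1)[OF subS]] w(2) by auto
  qed
  have "transport ls x \<in> S" if "set ls \<subseteq> J" for ls
    using that by (induction ls) (use S(2) inv in auto)
  moreover have "transport js x \<in> range_of h"
    using transport_in_range[OF js(1)] js J range_fvec[OF h] x by (auto simp: h_def)
  ultimately have mem: "transport js x \<in> col_space F C" "x \<in> col_space F C"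
    using js S(2) x line by (auto simp: h_def)
  have dim1: "fdim F d (col_space F C) = 1" using dim[OF hJ] line by simp
  show "\<exists>c\<in>F. transport js x = c \<cdot>\<^sub>v x"
  proof (cases "x = 0\<^sub>v d")
    case True
    then have "transport js x = 0\<^sub>v d" using transport_zero js J by auto
    then show ?thesis using True by (intro bexI[of _ 1]) auto
  next
    case False
    then show ?thesis using fdim_eq_1D[OF C dim1 mem(2) _ mem(1)] by blast
  qed
qed (rule js)

text \<open>A closed walk that visits a block twice contains a shorter closed walk, which acts as a
  scalar and can be cut out.\<close>

lemma all_scalar_if_distinct_scalar:
  assumes dist: "\<And>js. js \<noteq> [] \<Longrightarrow> set js \<subseteq> I \<Longrightarrow> distinct js \<Longrightarrow> scalar_cycle js"
    and "js \<noteq> []" "set js \<subseteq> I"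
  shows "scalar_cycle js"
  using assms(2,3)
proof (induction "length js" arbitrary: js rule: less_induct)
  case less
  show ?case
  proof (cases "distinct js")
    case False
    then obtain xs y ys zs where js: "js = xs @ [y] @ ys @ [y] @ zs"
      using not_distinct_decomp by blast
    have "scalar_cycle (y # ys)" using less js by (intro less.hyps) auto
    then obtain c where c: "c \<in> F" "\<And>x. x \<in> range_of y \<Longrightarrow> transport (y # ys) x = c \<cdot>\<^sub>v x"
      by (auto simp: scalar_cycle_def)
    have "scalar_cycle (xs @ y # zs)" using less js by (intro less.hyps) auto
    then obtain e where e: "e \<in> F"
      "\<And>x. x \<in> range_of (hd js) \<Longrightarrow> transport (xs @ y # zs) x = e \<cdot>\<^sub>v x"
      by (cases xs) (auto simp: scalar_cycle_def js)
    have "transport js x = (c * e) \<cdot>\<^sub>v x" if x: "x \<in> range_of (hd js)" for x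
    proof -
      have h: "hd js \<in> I" using less.prems by auto
      have xF: "x \<in> fvec F d" by (rule range_fvec[OF h x])
      have "transport (y # zs) x \<in> range_of y"
        using transport_in_range[of "y # zs" x] xF less.prems js by auto
      then have "transport js x = transport xs (c \<cdot>\<^sub>v transport (y # zs) x)"
        using c(2) js by simp
      also have "\<dots> = c \<cdot>\<^sub>v transport (xs @ y # zs) x"
        using transport_smult[of xs "transport (y # zs) x" c] transport_carrier[of "y # zs" x] less.prems js
          fvec_carrier[OF xF] by simp
      finally show ?thesis using e(2)[OF x] by (simp add: smult_smult_assoc)
    qed
    then show ?thesis using less.prems by (intro scalar_cycleI) auto
  qed (use less dist in auto)
qed

lemma division_edges_sym:
  assumes "(i, j) \<in> division_edges D I" shows "(j, i) \<in> division_edges D I"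
proof -
  have ij: "i \<in> I" "j \<in> I" "i \<noteq> j" "cnj_mat (D i) * (D j)\<^sup>T \<noteq> 0\<^sub>m (dim_row (D i)) (dim_row (D j))"
    using assms by (auto simp: division_edges_def)
  have "adj (cnj_mat (D j) * (D i)\<^sup>T) = adj ((D i)\<^sup>T) * adj (cnj_mat (D j))"
    using block_carrier(2)[OF ij(1)] block_carrier(3)[OF ij(2)] by (rule adj_mult[rotated])
  moreover have "adj ((D i)\<^sup>T) = cnj_mat (D i)" "adj (cnj_mat (D j)) = (D j)\<^sup>T" by (auto intro!: eq_matI)
  ultimately have "adj (cnj_mat (D j) * (D i)\<^sup>T) = cnj_mat (D i) * (D j)\<^sup>T" by simp
  moreover have "adj (0\<^sub>m (dim_row (D j)) (dim_row (D i))) = 0\<^sub>m (dim_row (D i)) (dim_row (D j))"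
    by (intro eq_matI) auto
  ultimately have "cnj_mat (D j) * (D i)\<^sup>T \<noteq> 0\<^sub>m (dim_row (D j)) (dim_row (D i))"
    using ij(4) by metis
  then show ?thesis using ij by (auto simp: division_edges_def)
qed

text \<open>For \<open>A = V\<^sub>i\<^sup>* V\<^sub>j\<close>, going to a neighbour and back is \<open>A * adj A\<close>, which is a nonzero scalar
  along an edge of the graph, and \<open>A\<close> vanishes where there is no edge.\<close>

lemma two_step_transport:
  assumes ij: "i \<in> I" "j \<in> I"
  obtains c where "\<And>x. x \<in> range_of i \<Longrightarrow> gram (D i) *\<^sub>v (gram (D j) *\<^sub>v x) = c \<cdot>\<^sub>v x"
    "(i, j) \<in> division_edges D I \<Longrightarrow> c \<noteq> 0"
    "i \<noteq> j \<Longrightarrow> (i, j) \<notin> division_edges D I \<Longrightarrow> (\<And>x. x \<in> range_of i \<Longrightarrow> gram (D j) *\<^sub>v x = 0\<^sub>v d)"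
proof -
  define A where "A = cnj_mat (D i) * (D j)\<^sup>T"
  note Vi = block_carrier(1,2,3)[OF ij(1)] and Vj = block_carrier(1,2,3)[OF ij(2)]
  have A: "A \<in> carrier_mat (r i) (r j)" "conformal A"
    using Vi Vj one_singular_value_conformal[OF isoclinic[OF ij]] by (auto simp: A_def)
  have "adj A = adj ((D j)\<^sup>T) * adj (cnj_mat (D i))" unfolding A_def using Vi Vj by (intro adj_mult) auto
  moreover have "adj ((D j)\<^sup>T) = cnj_mat (D j)" "adj (cnj_mat (D i)) = (D i)\<^sup>T" by (auto intro!: eq_matI)
  ultimately have adjA: "adj A = cnj_mat (D j) * (D i)\<^sup>T" by simp
  have edge: "(i, j) \<in> division_edges D I \<longleftrightarrow> i \<noteq> j \<and> A \<noteq> 0\<^sub>m (r i) (r j)"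
    using ij Vi(1) Vj(1) by (auto simp: division_edges_def A_def)
  have step: "gram (D j) *\<^sub>v ((D i)\<^sup>T *\<^sub>v y) = (D j)\<^sup>T *\<^sub>v (adj A *\<^sub>v y)" if y: "y \<in> carrier_vec (r i)" for y
    using gram_apply[OF ij(2) mult_mat_vec_carrier[OF Vi(2) y]] assoc_mult_mat_vec[OF Vj(3) Vi(2) y]
    by (simp add: adjA)
  have two: "gram (D i) *\<^sub>v (gram (D j) *\<^sub>v ((D i)\<^sup>T *\<^sub>v y)) = (D i)\<^sup>T *\<^sub>v ((A * adj A) *\<^sub>v y)"
    if y: "y \<in> carrier_vec (r i)" for y
  proof -
    have aA: "adj A \<in> carrier_mat (r j) (r i)" using A(1) by simp
    have z: "adj A *\<^sub>v y \<in> carrier_vec (r j)" by (rule mult_mat_vec_carrier[OF aA y])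
    have "gram (D i) *\<^sub>v (gram (D j) *\<^sub>v ((D i)\<^sup>T *\<^sub>v y)) = (D i)\<^sup>T *\<^sub>v (cnj_mat (D i) *\<^sub>v ((D j)\<^sup>T *\<^sub>v (adj A *\<^sub>v y)))"
      using step[OF y] gram_apply[OF ij(1) mult_mat_vec_carrier[OF Vj(2) z]] by simp
    also have "cnj_mat (D i) *\<^sub>v ((D j)\<^sup>T *\<^sub>v (adj A *\<^sub>v y)) = A *\<^sub>v (adj A *\<^sub>v y)"
      unfolding A_def using assoc_mult_mat_vec[OF Vi(3) Vj(2) z[unfolded A_def]] by simp
    also have "\<dots> = (A * adj A) *\<^sub>v y" using assoc_mult_mat_vec[OF A(1) aA y] by simp
    finally show ?thesis .
  qed
  have range: "\<exists>y. y \<in> carrier_vec (r i) \<and> x = (D i)\<^sup>T *\<^sub>v y" if "x \<in> range_of i" for x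
    using that range_iff[OF ij(1)] fvec_carrier by blast
  show ?thesis
  proof (cases "A = 0\<^sub>m (r i) (r j)")
    case True
    have "adj A = 0\<^sub>m (r j) (r i)" unfolding True by (intro eq_matI) auto
    then have zero: "gram (D j) *\<^sub>v x = 0\<^sub>v d" if x: "x \<in> range_of i" for x
    proof -
      obtain y where y: "y \<in> carrier_vec (r i)" "x = (D i)\<^sup>T *\<^sub>v y" using range[OF x] by blast
      have "adj A *\<^sub>v y = 0\<^sub>v (r j)" unfolding \<open>adj A = 0\<^sub>m (r j) (r i)\<close> using y(1) by auto
      then show ?thesis using step[OF y(1)] y(2) mult_mat_zero_vec[OF Vj(2)] by simp
    qed
    show ?thesis
    proof (rule that[of 0])
      fix x assume x: "x \<in> range_of i"
      have "0 \<cdot>\<^sub>v x = 0\<^sub>v d" using range_carrier[OF ij(1) x] by (intro eq_vecI) auto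
      then show "gram (D i) *\<^sub>v (gram (D j) *\<^sub>v x) = 0 \<cdot>\<^sub>v x"
        using zero[OF x] mult_mat_zero_vec[OF block_carrier(4)[OF ij(1)]] by simp
    qed (use zero edge True in auto)
  next
    case False
    obtain c where c: "c \<noteq> 0" "A * adj A = c \<cdot>\<^sub>m 1\<^sub>m (r i)"
      using conformal_nonzero_cases[OF A False] by metis
    show ?thesis
    proof (rule that[of c])
      fix x assume x: "x \<in> range_of i"
      then obtain y where y: "y \<in> carrier_vec (r i)" "x = (D i)\<^sup>T *\<^sub>v y" using range by blast
      then show "gram (D i) *\<^sub>v (gram (D j) *\<^sub>v x) = c \<cdot>\<^sub>v x"
        using two[OF y(1)] c(2) Vi(2) by (simp add: smult_mat_mult_vec[of _ "r i" "r i"] mult_mat_vec)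
    qed (use c edge False in auto)
  qed
qed

lemma scalar_cycle_short:
  assumes "js \<noteq> []" "set js \<subseteq> I" "length js \<le> 2"
  shows "scalar_cycle js"
proof (cases js)
  case (Cons i ks)
  show ?thesis
  proof (cases ks)
    case Nil
    show ?thesis unfolding Cons Nil
      by (rule scalar_cycleI[of _ "a i"]) (use Cons Nil assms in \<open>auto simp: gram_range\<close>)
  next
    case (Cons j ls)
    then have js: "js = [i, j]" using \<open>js = i # ks\<close> assms(3) by auto
    then have "i \<in> I" "j \<in> I" using assms(2) by auto
    from two_step_transport[OF this] obtain c where
      "\<And>x. x \<in> range_of i \<Longrightarrow> gram (D i) *\<^sub>v (gram (D j) *\<^sub>v x) = c \<cdot>\<^sub>v x" by metis
    then show ?thesis using js assms(2) by (intro scalar_cycleI[of _ c]) auto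
  qed
qed (use assms in simp)

end

section \<open>Lines aligned along the blocks\<close>

context isoclinic_family
begin

text \<open>Every step along an edge is undone by the step back, up to a nonzero factor. Both
  composites are recorded: the one at \<open>j\<close> serves to compare two vectors there, the one at \<open>i\<close>
  shows that transport along \<open>w\<close> is injective on \<open>range_of i\<close>.\<close>

lemma reversible_path:
  assumes "(i, j) \<in> (division_edges D I)\<^sup>*" "i \<in> I"
  shows "j \<in> I \<and> (\<exists>w w' c c'. w \<noteq> [] \<and> w' \<noteq> [] \<and> set w \<subseteq> I \<and> set w' \<subseteq> I \<and> hd w = j \<and> hd w' = i \<and>
    c \<noteq> 0 \<and> (\<forall>y\<in>range_of j. transport w (transport w' y) = c \<cdot>\<^sub>v y) \<and>
    c' \<noteq> 0 \<and> (\<forall>x\<in>range_of i. transport w' (transport w x) = c' \<cdot>\<^sub>v x))"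
  using assms(1)
proof (induction rule: rtrancl_induct)
  case base
  have "gram (D i) *\<^sub>v (gram (D i) *\<^sub>v x) = (a i * a i) \<cdot>\<^sub>v x" if "x \<in> range_of i" for x
    using assms(2) gram_range[OF assms(2) that] that range_carrier[OF assms(2) that]
    by (simp add: mult_mat_vec[OF block_carrier(4)] smult_smult_assoc)
  then show ?case using assms(2) scale(2)[OF assms(2)]
    by (intro conjI exI[of _ "[i]"] exI[of _ "a i * a i"]) auto
next
  case (step j k)
  then have jI: "j \<in> I" by simp
  have kI: "k \<in> I" using step(2) by (auto simp: division_edges_def)
  obtain w w' c c' where w: "w \<noteq> []" "w' \<noteq> []" "set w \<subseteq> I" "set w' \<subseteq> I" "hd w = j" "hd w' = i"
    "c \<noteq> 0" "\<And>y. y \<in> range_of j \<Longrightarrow> transport w (transport w' y) = c \<cdot>\<^sub>v y"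
    "c' \<noteq> 0" "\<And>x. x \<in> range_of i \<Longrightarrow> transport w' (transport w x) = c' \<cdot>\<^sub>v x"
    using step.IH by blast
  from two_step_transport[OF kI jI] division_edges_sym[OF step(2)]
  obtain f where f: "f \<noteq> 0" "\<And>x. x \<in> range_of k \<Longrightarrow> gram (D k) *\<^sub>v (gram (D j) *\<^sub>v x) = f \<cdot>\<^sub>v x" by metis
  from two_step_transport[OF jI kI] step(2)
  obtain e where e: "e \<noteq> 0" "\<And>x. x \<in> range_of j \<Longrightarrow> gram (D j) *\<^sub>v (gram (D k) *\<^sub>v x) = e \<cdot>\<^sub>v x" by metis
  have 1: "transport (k # w) (transport (w' @ [j]) y) = (c * f) \<cdot>\<^sub>v y" if y: "y \<in> range_of k" for y
  proof -
    have "gram (D j) *\<^sub>v y \<in> range_of j" using gram_in_range[OF jI range_fvec[OF kI y]] .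
    then have "transport (k # w) (transport (w' @ [j]) y) = gram (D k) *\<^sub>v (c \<cdot>\<^sub>v (gram (D j) *\<^sub>v y))"
      using w(8) by simp
    also have "\<dots> = (c * f) \<cdot>\<^sub>v y"
      using f(2)[OF y] jI by (simp add: mult_mat_vec[OF block_carrier(4)[OF kI]] smult_smult_assoc)
    finally show ?thesis .
  qed
  have 2: "transport (w' @ [j]) (transport (k # w) x) = (e * c') \<cdot>\<^sub>v x" if x: "x \<in> range_of i" for x
  proof -
    have "transport w x \<in> range_of j"
      using transport_in_range[OF w(1,3) range_fvec[OF assms(2) x]] w(5) by simp
    then have "transport (w' @ [j]) (transport (k # w) x) = transport w' (e \<cdot>\<^sub>v transport w x)"
      using e(2) by simp
    also have "\<dots> = (e * c') \<cdot>\<^sub>v x"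
      using transport_smult[OF w(4) transport_carrier[OF w(3) range_carrier[OF assms(2) x]]] w(10)[OF x]
      by (simp add: smult_smult_assoc)
    finally show ?thesis .
  qed
  show ?case
    using 1 2 w kI jI e(1) f(1)
    by (intro conjI exI[of _ "k # w"] exI[of _ "w' @ [j]"] exI[of _ "c * f"] exI[of _ "e * c'"])
      (auto simp del: transport_simps)
qed

text \<open>Each component of the graph has a representative block with a chosen vector in it, which is
  \<open>h\<close> with \<open>v\<close> for the component of \<open>h\<close>. Transporting it along any path gives the vectors \<open>u j\<close>;
  another path gives a multiple, because two paths differ by a closed walk.\<close>

lemma aligned_family:
  assumes all: "\<And>js. js \<noteq> [] \<Longrightarrow> set js \<subseteq> I \<Longrightarrow> scalar_cycle js"
    and h: "h \<in> I" and v: "v \<in> range_of h" "v \<noteq> 0\<^sub>v d"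
  obtains u where "\<And>j. j \<in> I \<Longrightarrow> u j \<in> range_of j" "\<And>j. j \<in> I \<Longrightarrow> u j \<noteq> 0\<^sub>v d"
    "\<And>i j. i \<in> I \<Longrightarrow> j \<in> I \<Longrightarrow> \<exists>c\<in>F. gram (D j) *\<^sub>v u i = c \<cdot>\<^sub>v u j"
    "\<exists>c\<in>F. v = c \<cdot>\<^sub>v u h"
proof -
  let ?E = "(division_edges D I)\<^sup>*"
  have symE: "(j, i) \<in> ?E" if "(i, j) \<in> ?E" for i j
    using that division_edges_sym by (metis sym_rtrancl symI symD)
  define rep where "rep j = (if (h, j) \<in> ?E then h else (LEAST i. (i, j) \<in> ?E))" for j
  have rep: "(rep j, j) \<in> ?E" for j
    unfolding rep_def by (auto intro: LeastI[of "\<lambda>i. (i, j) \<in> ?E" j])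
  have repI: "rep j \<in> I" if "j \<in> I" for j
  proof -
    have "(j, rep j) \<in> ?E" by (rule symE[OF rep])
    then show ?thesis using reversible_path[OF _ that] by blast
  qed
  have rep_edge: "rep i = rep j" if "(i, j) \<in> division_edges D I" for i j
  proof -
    have "(k, i) \<in> ?E \<longleftrightarrow> (k, j) \<in> ?E" for k
      using that division_edges_sym[OF that] by (meson rtrancl.rtrancl_into_rtrancl)
    then show ?thesis by (simp add: rep_def)
  qed
  have reph: "rep h = h" by (simp add: rep_def)
  define x where "x i = (if i = h then v else (SOME x. x \<in> range_of i \<and> x \<noteq> 0\<^sub>v d))" for i
  have x: "x i \<in> range_of i" "x i \<noteq> 0\<^sub>v d" if "i \<in> I" for i
    using someI_ex[of "\<lambda>x. x \<in> range_of i \<and> x \<noteq> 0\<^sub>v d"] range_nonzero[OF that] v by (auto simp: x_def)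
  define good where "good j w w' c c' \<longleftrightarrow> w \<noteq> [] \<and> w' \<noteq> [] \<and> set w \<subseteq> I \<and> set w' \<subseteq> I \<and> hd w = j \<and>
    hd w' = rep j \<and> c \<noteq> 0 \<and> (\<forall>y\<in>range_of j. transport w (transport w' y) = c \<cdot>\<^sub>v y) \<and>
    c' \<noteq> 0 \<and> (\<forall>x\<in>range_of (rep j). transport w' (transport w x) = c' \<cdot>\<^sub>v x)" for j w w' c and c' :: complex
  have "\<forall>j\<in>I. \<exists>w w' c c'. good j w w' c c'"
    unfolding good_def using reversible_path[OF rep repI] by blast
  then obtain w w' c c' where good: "\<And>j. j \<in> I \<Longrightarrow> good j (w j) (w' j) (c j) (c' j)"
    by metis
  define u where "u j = transport (w j) (x (rep j))" for j
  have xF: "x (rep j) \<in> fvec F d" if "j \<in> I" for j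
    by (rule range_fvec[OF repI[OF that] x(1)[OF repI[OF that]]])
  have uR: "u j \<in> range_of j" if "j \<in> I" for j
    using transport_in_range[OF _ _ xF[OF that], of "w j"] good[OF that] by (auto simp: u_def good_def)
  have u0: "u j \<noteq> 0\<^sub>v d" if j: "j \<in> I" for j
  proof
    assume "u j = 0\<^sub>v d"
    then have "c' j \<cdot>\<^sub>v x (rep j) = 0\<^sub>v d"
      using good[OF j] x(1)[OF repI[OF j]] transport_zero[of "w' j"] unfolding good_def u_def
      by metis
    moreover obtain k where k: "k < d" "x (rep j) $ k \<noteq> 0"
      using nonzero_vec_index[OF fvec_carrier[OF xF[OF j]] x(2)[OF repI[OF j]]] .
    ultimately have "c' j * x (rep j) $ k = 0"
      using fvec_carrier[OF xF[OF j]] by (metis carrier_vecD index_smult_vec(1) index_zero_vec(1))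
    then show False using k good[OF j] by (simp add: good_def)
  qed
  \<comment> \<open>two walks from the representative to \<open>j\<close> differ by a closed walk at the representative\<close>
  have walk: "\<exists>e\<in>F. y = e \<cdot>\<^sub>v u j"
    if j: "j \<in> I" and y: "y \<in> range_of j" "y = transport ks (x (rep j))" and ks: "set ks \<subseteq> I" for j y ks
  proof -
    have g: "w' j \<noteq> []" "set (w' j) \<subseteq> I" "hd (w' j) = rep j" "set (w j) \<subseteq> I" "c j \<noteq> 0"
      using good[OF j] by (auto simp: good_def)
    have "scalar_cycle (w' j @ ks)" using all[of "w' j @ ks"] g ks by simp
    then obtain e where e: "transport (w' j @ ks) (x (rep j)) = e \<cdot>\<^sub>v x (rep j)"
      using x(1)[OF repI[OF j]] g by (auto simp: scalar_cycle_def)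
    have "c j \<cdot>\<^sub>v y = transport (w j) (transport (w' j) y)" using good[OF j] y(1) by (simp add: good_def)
    also have "\<dots> = e \<cdot>\<^sub>v u j"
      using e y(2) transport_smult[OF g(4) fvec_carrier[OF xF[OF j]]] by (simp add: u_def)
    finally have "inverse (c j) \<cdot>\<^sub>v (c j \<cdot>\<^sub>v y) = (inverse (c j) * e) \<cdot>\<^sub>v u j" by (simp add: smult_smult_assoc)
    then have eq: "y = (inverse (c j) * e) \<cdot>\<^sub>v u j" using g(5) by (simp add: smult_smult_assoc)
    then show ?thesis
      using eigenvalue_in_F[OF range_fvec[OF j uR[OF j]] u0[OF j]] range_fvec[OF j y(1)] by metis
  qed
  have "\<exists>e\<in>F. gram (D j) *\<^sub>v u i = e \<cdot>\<^sub>v u j" if ij: "i \<in> I" "j \<in> I" for i j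
  proof (cases "i = j \<or> (i, j) \<in> division_edges D I")
    case True
    then have "rep i = rep j" using rep_edge by auto
    then show ?thesis
      using walk[OF ij(2), of "gram (D j) *\<^sub>v u i" "j # w i"] ij good[OF ij(1)]
        gram_in_range[OF ij(2) range_fvec[OF ij(1) uR[OF ij(1)]]]
      by (auto simp: u_def good_def)
  next
    case False
    then have "gram (D j) *\<^sub>v u i = 0\<^sub>v d" using two_step_transport[OF ij] uR[OF ij(1)] by metis
    moreover have "0 \<cdot>\<^sub>v u j = 0\<^sub>v d" using range_carrier[OF ij(2) uR[OF ij(2)]] by (intro eq_vecI) auto
    ultimately show ?thesis by (intro bexI[of _ 0]) auto
  qed
  moreover have "\<exists>e\<in>F. v = e \<cdot>\<^sub>v u h"
    using walk[OF h v(1), of "[]"] by (simp add: reph x_def)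
  ultimately show ?thesis using that uR u0 by blast
qed

end

section \<open>Row separation subspaces from invariant subspaces\<close>

lemma permutation_onto_prefix:
  assumes "G \<subseteq> {..<N}"
  obtains p where "p permutes {..<N}" "\<And>i. i < N \<Longrightarrow> p i \<in> G \<longleftrightarrow> i < card G" "G = p ` {..<card G}"
proof -
  let ?g = "card G"
  have fin: "finite G" using assms finite_subset by blast
  have gN: "?g \<le> N" using card_mono[OF _ assms] by simp
  obtain f where f: "bij_betw f {..<?g} G"
    using finite_same_card_bij[of "{..<?g}" G] fin by auto
  have "card {?g..<N} = card ({..<N} - G)" using card_Diff_subset[OF fin assms] by simp
  then obtain f' where f': "bij_betw f' {?g..<N} ({..<N} - G)"
    using finite_same_card_bij[of "{?g..<N}" "{..<N} - G"] by auto
  define p where "p i = (if i < ?g then f i else if i < N then f' i else i)" for i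
  have p1: "bij_betw p {..<?g} G" using f by (rule bij_betw_cong[THEN iffD1, rotated]) (simp add: p_def)
  have p2: "bij_betw p {?g..<N} ({..<N} - G)"
    using f' by (rule bij_betw_cong[THEN iffD1, rotated]) (simp add: p_def)
  have "bij_betw p ({..<?g} \<union> {?g..<N}) (G \<union> ({..<N} - G))"
    by (rule bij_betw_combine[OF p1 p2]) auto
  then have "bij_betw p {..<N} {..<N}" using gN assms by (simp add: ivl_disj_un Un_absorb1)
  then have perm: "p permutes {..<N}" by (rule bij_imp_permutes) (use gN in \<open>auto simp: p_def\<close>)
  have "p i \<in> G \<longleftrightarrow> i < ?g" if "i < N" for i
    using bij_betwE[OF p1] bij_betwE[OF p2] that by (cases "i < ?g") auto
  with perm p1 that show ?thesis by (simp add: bij_betw_def)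
qed

lemma (in ground_field) unitary_adapted_to_subspace:
  assumes Y: "fsubspace n Y"
  obtains U s where "unitary_mat F n U" "s \<le> n" "\<And>k. k < s \<Longrightarrow> row U k \<in> Y"
    "\<And>k y. s \<le> k \<Longrightarrow> k < n \<Longrightarrow> y \<in> Y \<Longrightarrow> y \<bullet>c row U k = 0"
proof -
  obtain q s where q: "s \<le> n" "orthonormal_family n q" "\<forall>k<n. q k \<in> fvec F n" "\<forall>k<s. q k \<in> Y"
    "\<forall>k. s \<le> k \<and> k < n \<longrightarrow> (\<forall>x\<in>Y. x \<bullet>c q k = 0)"
    using adapted_orthonormal_basis[OF Y] by blast
  define U where "U = mat n n (\<lambda>(k, i). q k $ i)"
  have U: "U \<in> carrier_mat n n" by (simp add: U_def)
  have row: "row U k = q k" if "k < n" for k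
    using that q(3) by (intro eq_vecI) (auto simp: U_def fvec_iff)
  have "U * adj U = 1\<^sub>m n"
  proof (rule eq_matI)
    fix k l assume kl: "k < dim_row (1\<^sub>m n)" "l < dim_col (1\<^sub>m n)"
    then have "(U * adj U) $$ (k, l) = row U k \<bullet>c row U l"
      using U by (auto simp: scalar_prod_def)
    also have "\<dots> = 1\<^sub>m n $$ (k, l)" using kl q(2) by (simp add: row orthonormal_family_def)
    finally show "(U * adj U) $$ (k, l) = 1\<^sub>m n $$ (k, l)" .
  qed (use U in auto)
  then have "adj U * U = 1\<^sub>m n" using mat_mult_left_right_inverse[of U n "adj U"] U by simp
  moreover have "U \<in> fmat F n n" using q(3) by (auto simp: U_def fmat_iff fvec_iff)
  ultimately have "unitary_mat F n U" by (simp add: unitary_mat_def mat_adjoint_eq_adj)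
  then show ?thesis using that[of U s] q by (auto simp: row)
qed

context isoclinic_family
begin

text \<open>Pull \<open>S\<close> back along \<open>V\<^sub>j\<close> to a subspace \<open>Y\<close> of the coordinate space and take the rows of \<open>H\<close>
  from an orthonormal basis adapted to \<open>Y\<close>. A row orthogonal to \<open>Y\<close> gives a vector orthogonal to
  \<open>S\<close>, because the adjoint of \<open>V\<^sub>j\<close> maps \<open>S\<close> into \<open>Y\<close> by invariance.\<close>

lemma unitary_splitting_block:
  assumes S: "fsubspace d S" and inv: "\<And>s. s \<in> S \<Longrightarrow> gram (D j) *\<^sub>v s \<in> S" and j: "j \<in> I"
  shows "\<exists>H. unitary_mat F (r j) H \<and>
    (\<forall>i<r j. row (H * D j) i \<in> S \<or> (\<forall>s\<in>S. s \<bullet>c row (H * D j) i = 0))"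
proof -
  note V = block_carrier(1,2,3)[OF j]
  define Y where "Y = {y \<in> fvec F (r j). (D j)\<^sup>T *\<^sub>v y \<in> S}"
  have Y: "fsubspace (r j) Y"
    unfolding fsubspace_def Y_def using fsubspaceD(3,4,5)[OF S] V(2) mult_mat_zero_vec[OF V(2)]
    by (auto simp: mult_add_distrib_mat_vec[OF V(2)] mult_mat_vec[OF V(2)] fvec_carrier)
  from unitary_adapted_to_subspace[OF Y] obtain H s where H: "unitary_mat F (r j) H"
    "\<And>k. k < s \<Longrightarrow> row H k \<in> Y" "\<And>k y. s \<le> k \<Longrightarrow> k < r j \<Longrightarrow> y \<in> Y \<Longrightarrow> y \<bullet>c row H k = 0"
    by metis
  have Hc: "H \<in> carrier_mat (r j) (r j)" by (rule unitary_matD(2)[OF H(1)])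
  have row: "row (H * D j) i = (D j)\<^sup>T *\<^sub>v row H i" if "i < r j" for i
    using that Hc V(1) by (intro eq_vecI) (auto simp: scalar_prod_def mult.commute intro!: sum.cong)
  have "row (H * D j) i \<in> S \<or> (\<forall>x\<in>S. x \<bullet>c row (H * D j) i = 0)" if i: "i < r j" for i
  proof (cases "i < s")
    case True then show ?thesis using H(2)[of i] row[OF i] by (auto simp: Y_def)
  next
    case False
    have Hi: "row H i \<in> carrier_vec (r j)" using Hc i by auto
    have "x \<bullet>c row (H * D j) i = 0" if x: "x \<in> S" for x
    proof -
      have xc: "x \<in> carrier_vec d" by (rule fsubspaceD(2)[OF S x])
      have "cnj_mat (D j) *\<^sub>v x \<in> Y"
        using inv[OF x] gram_apply[OF j xc] fmat_mult_vec[OF block_carrier(7)[OF j] fsubspaceD(1)[OF S x]]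
        by (simp add: Y_def)
      then have "(cnj_mat (D j) *\<^sub>v x) \<bullet>c row H i = 0" using H(3) False i by auto
      moreover have "adj (cnj_mat (D j)) = (D j)\<^sup>T" by (intro eq_matI) auto
      ultimately show ?thesis using cscalar_prod_adjoint[OF V(3) xc Hi] row[OF i] by simp
    qed
    then show ?thesis by blast
  qed
  then show ?thesis using H(1) by blast
qed

text \<open>Two diagonal blocks suffice. Choose each \<open>H j\<close> such that every row of \<open>H j * D j\<close> lies in
  \<open>S\<close> or is orthogonal to \<open>S\<close>, let \<open>E\<close> move the rows in \<open>S\<close> to the top, and let \<open>cnj L\<close> have an
  orthonormal basis of \<open>S\<close> as its first columns. \<open>T\<close> is then the span of the rows in \<open>S\<close>, and
  these rows alone contribute to \<open>gram (D j) *\<^sub>v s\<close>.\<close>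

lemma invariant_subspace_yields_row_separation:
  assumes S: "fsubspace d S" and inv: "\<And>j s. j \<in> I \<Longrightarrow> s \<in> S \<Longrightarrow> gram (D j) *\<^sub>v s \<in> S"
  obtains E H L Bs t T where "row_separation_solution F d D I E H L Bs" "t < length Bs"
    "T = col_space F (cnj_mat L * (block_row Bs t)\<^sup>T)" "fsubspace d T" "T \<subseteq> S"
    "\<And>j s. j \<in> I \<Longrightarrow> s \<in> S \<Longrightarrow> gram (D j) *\<^sub>v s \<in> T"
proof -
  have "\<forall>j\<in>I. \<exists>H. unitary_mat F (r j) H \<and>
      (\<forall>i<r j. row (H * D j) i \<in> S \<or> (\<forall>s\<in>S. s \<bullet>c row (H * D j) i = 0))"
    using unitary_splitting_block[OF S inv] by blast
  then obtain H where H: "\<And>j. j \<in> I \<Longrightarrow> unitary_mat F (r j) (H j)"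
    "\<And>j i. j \<in> I \<Longrightarrow> i < r j \<Longrightarrow> row (H j * D j) i \<in> S \<or> (\<forall>s\<in>S. s \<bullet>c row (H j * D j) i = 0)"
    by metis
  from unitary_adapted_to_subspace[OF S] obtain U m where U: "unitary_mat F d U" "m \<le> d"
    "\<And>k. k < m \<Longrightarrow> row U k \<in> S" "\<And>k y. m \<le> k \<Longrightarrow> k < d \<Longrightarrow> y \<in> S \<Longrightarrow> y \<bullet>c row U k = 0" by metis
  note Uc = unitary_matD[OF U(1)]
  define L where "L = adj U"
  have cnjL: "cnj_mat L = U\<^sup>T" unfolding L_def by (intro eq_matI) auto
  have L: "L \<in> carrier_mat d d" using Uc(2) by (simp add: L_def)
  have unitL: "unitary_mat F d L"
    using Uc by (auto simp: unitary_mat_def mat_adjoint_eq_adj L_def)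
  define js where "js = sorted_list_of_set I"
  define N where "N = (\<Sum>j\<in>I. dim_row (D j))"
  define X where "X = stack_rows d (map (\<lambda>j. H j * D j) js)"
  have Hc: "H j \<in> carrier_mat (r j) (r j)" if "j \<in> I" for j by (rule unitary_matD(2)[OF H(1)[OF that]])
  note stacked = stacked_product[of I H r D d, OF finite_index, folded js_def N_def]
  have X: "X \<in> carrier_mat N d"
    unfolding X_def by (rule stacked(1)[OF Hc block_carrier(1)])
  have X_rows: "(\<exists>n<N. v = row X n) \<longleftrightarrow> (\<exists>j\<in>I. \<exists>i<r j. v = row (H j * D j) i)" for v
    unfolding X_def by (rule stacked(3)[OF Hc block_carrier(1)])
  define G where "G = {n. n < N \<and> row X n \<in> S}"
  have X_perp: "s \<bullet>c row X n = 0" if n: "n < N" "n \<notin> G" "s \<in> S" for n s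
  proof -
    obtain j i where "j \<in> I" "i < r j" "row X n = row (H j * D j) i"
      using X_rows[of "row X n"] n(1) by blast
    then show ?thesis using H(2)[of j i] n by (auto simp: G_def)
  qed
  obtain p where p: "p permutes {..<N}" "\<And>i. i < N \<Longrightarrow> p i \<in> G \<longleftrightarrow> i < card G" "G = p ` {..<card G}"
    using permutation_onto_prefix[of G N] by (auto simp: G_def)
  define g where "g = card G"
  have gN: "g \<le> N" unfolding g_def using card_mono[of "{..<N}" G] by (auto simp: G_def)
  define E :: "complex mat" where "E = mat N N (\<lambda>(i, j). if p i = j then 1 else 0)"
  have E: "E \<in> carrier_mat N N" by (simp add: E_def)
  define Z where "Z = E * X * L"
  have Z: "Z \<in> carrier_mat N d" using E X L by (simp add: Z_def)
  have rowZ: "row Z i = L\<^sup>T *\<^sub>v row X (p i)" if i: "i < N" for i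
  proof -
    have EX: "E * X \<in> carrier_mat N d" using E X by simp
    have "row Z i = L\<^sup>T *\<^sub>v row (E * X) i"
      unfolding Z_def using EX L i by (intro eq_vecI) (auto simp: comm_scalar_prod[of _ d])
    then show ?thesis using permutation_matrix_mult[OF E_def p(1) X i] by simp
  qed
  have pN: "p i < N" if "i < N" for i using permutes_in_image[OF p(1), of i] that by simp
  have Zij: "Z $$ (i, k) = row X (p i) \<bullet>c row U k" if "i < N" "k < d" for i k
  proof -
    have "Z $$ (i, k) = row Z i $ k" using that Z by simp
    also have "\<dots> = row X (p i) \<bullet>c row U k"
      using rowZ[OF that(1)] that X Uc(2) pN[OF that(1)] by (auto simp: L_def scalar_prod_def mult.commute)
    finally show ?thesis .
  qed
  have zero1: "Z $$ (i, k) = 0" if "i < g" "m \<le> k" "k < d" for i k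
  proof -
    have "row X (p i) \<in> S" using p(2)[of i] that gN by (auto simp: g_def G_def)
    then show ?thesis using Zij[of i k] U(4) that gN by auto
  qed
  have zero2: "Z $$ (i, k) = 0" if i: "g \<le> i" "i < N" "k < m" for i k
  proof -
    have "row U k \<bullet>c row X (p i) = 0"
      using X_perp[OF pN[OF i(2)], of "row U k"] p(2)[OF i(2)] U(3) i by (auto simp: g_def)
    moreover have "row U k \<in> carrier_vec d" "row X (p i) \<in> carrier_vec d"
      using Uc(2) X pN i U(2) by auto
    ultimately show ?thesis
      using Zij[of i k] i U(2) cscalar_prod_simps(6)[of "row U k" d _ "row X (p i)"] by auto
  qed
  define Bs where "Bs = [mat g m (\<lambda>(i, k). Z $$ (i, k)), mat (N - g) (d - m) (\<lambda>(i, k). Z $$ (g + i, m + k))]"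
  have diag: "diag_block_mat Bs = Z"
    using Z zero1 zero2 gN U(2) by (intro eq_matI) (auto simp: Bs_def Let_def)
  have brow: "block_row Bs 0 = mat g d (\<lambda>(i, k). Z $$ (i, k))"
    unfolding block_row_def diag using Z by (auto simp: Bs_def)
  define C where "C = cnj_mat L * (block_row Bs 0)\<^sup>T"
  have B: "(block_row Bs 0)\<^sup>T \<in> carrier_mat d g" by (simp add: brow)
  have Cc: "C \<in> carrier_mat d g" unfolding C_def using B L by (intro mult_carrier_mat) auto
  have colC: "col C i = row X (p i)" if i: "i < g" for i
  proof -
    have iN: "i < N" using i gN by simp
    have rX: "row X (p i) \<in> carrier_vec d" using X pN[OF iN] by auto
    have "col ((block_row Bs 0)\<^sup>T) i = row Z i"
      using i iN Z by (intro eq_vecI) (auto simp: brow)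
    then have "col C i = U\<^sup>T *\<^sub>v (L\<^sup>T *\<^sub>v row X (p i))"
      unfolding C_def using col_mult2[OF _ B i, of "cnj_mat L" d] L Uc(2) rowZ[OF iN] by (simp add: cnjL)
    also have "\<dots> = (U\<^sup>T * cnj_mat U) *\<^sub>v row X (p i)"
    proof -
      have "L\<^sup>T = cnj_mat U" unfolding L_def by (intro eq_matI) auto
      then show ?thesis using assoc_mult_mat_vec[of "U\<^sup>T" d d "cnj_mat U" d "row X (p i)"] Uc(2) rX by simp
    qed
    also have "\<dots> = row X (p i)" using Uc(5) rX by simp
    finally show ?thesis .
  qed
  have colS: "col C i \<in> S" if "i < g" for i
    using colC[OF that] p(2)[of i] that gN by (auto simp: g_def G_def)
  have CF: "C \<in> fmat F d g"
    unfolding fmat_iff using Cc colS fsubspaceD(1)[OF S]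
    by (metis carrier_matD fvec_iff index_col)
  define T where "T = col_space F C"
  have T: "fsubspace d T" unfolding T_def by (rule fsubspace_col_space[OF CF])
  have TS: "T \<subseteq> S"
    unfolding T_def col_space_def using Cc colS by (auto intro!: mult_mat_vec_mem_fsubspace[OF S])
  have "gram (D j) *\<^sub>v s \<in> T" if j: "j \<in> I" and s: "s \<in> S" for j s
  proof -
    have "gram (H j * D j) *\<^sub>v s \<in> T"
    proof (rule gram_mem_fsubspace[OF _ T])
      show "H j * D j \<in> fmat F (r j) d" using unitary_matD(1)[OF H(1)[OF j]] block[OF j] by (rule fmat_mult)
      fix i assume i: "i < r j"
      show "row (H j * D j) i \<in> T \<or> s \<bullet>c row (H j * D j) i = 0"
      proof (cases "row (H j * D j) i \<in> S")
        case True
        obtain n where n: "n < N" "row (H j * D j) i = row X n" using X_rows i j by blast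
        then have "n \<in> G" using True by (simp add: G_def)
        then obtain l where l: "l < g" "n = p l" using p(3) by (auto simp: g_def)
        then show ?thesis using colC[OF l(1)] col_mem_col_space[OF CF l(1)] n by (simp add: T_def)
      qed (use H(2)[OF j i] s in auto)
    qed (rule fsubspaceD(1)[OF S s])
    then show ?thesis using gram_unitary_mult[OF H(1)[OF j] block_carrier(1)[OF j]] by simp
  qed
  moreover have "row_separation_solution F d D I E H L Bs"
  proof -
    have "dim_row (D j) = r j" if "j \<in> I" for j using block_carrier(1)[OF that] by auto
    moreover have "permutation_matrix N E" using p(1) by (auto simp: permutation_matrix_def E_def)
    moreover have "E * diag_block_mat (map H js) * stack_rows d (map D js) = E * X"
      unfolding X_def by (rule stacked(2)[OF Hc block_carrier(1) E])
    ultimately show ?thesis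
      using H(1) unitL diag by (simp add: row_separation_solution_def js_def N_def Z_def)
  qed
  ultimately show ?thesis
    using that[of E H L Bs 0 T] T TS by (simp add: Bs_def T_def C_def)
qed

text \<open>Once an aligned family is known, the vectors that every \<open>gram (D j)\<close> sends into the line of
  \<open>u j\<close> form an invariant subspace, which meets each row space in that line.\<close>

lemma collection_condition_if_all_scalar:
  assumes all: "\<And>js. js \<noteq> [] \<Longrightarrow> set js \<subseteq> I \<Longrightarrow> scalar_cycle js" and ne: "I \<noteq> {}"
  shows "collection_condition F d D I (card I)"
  unfolding collection_condition_def
proof (intro allI impI ballI)
  fix js v assume js: "length js = card I \<and> distinct js \<and> set js \<subseteq> I" and v: "v \<in> range_of (hd js)"
  then have setjs: "set js = I" using finite_index by (metis card_subset_eq distinct_card)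
  define h where "h = hd js"
  have h: "h \<in> I" unfolding h_def using setjs ne hd_in_set[of js] by auto
  (* the zero vector belongs to every subspace, but aligned lines need a nonzero starting vector *)
  obtain v' where v': "v' \<in> range_of h" "v' \<noteq> 0\<^sub>v d" "v = v' \<or> v = 0\<^sub>v d"
    using range_nonzero[OF h] v by (cases "v = 0\<^sub>v d") (auto simp: h_def)
  from aligned_family[OF all h v'(1,2)] obtain u where u: "\<And>j. j \<in> I \<Longrightarrow> u j \<in> range_of j"
    "\<And>j. j \<in> I \<Longrightarrow> u j \<noteq> 0\<^sub>v d" "\<And>i j. i \<in> I \<Longrightarrow> j \<in> I \<Longrightarrow> \<exists>c\<in>F. gram (D j) *\<^sub>v u i = c \<cdot>\<^sub>v u j"
    "\<exists>c\<in>F. v' = c \<cdot>\<^sub>v u h" by metis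
  define K where "K j = {c \<cdot>\<^sub>v u j | c. c \<in> F}" for j
  define S where "S = {x \<in> fvec F d. \<forall>j\<in>I. gram (D j) *\<^sub>v x \<in> K j}"
  have K: "fsubspace d (K j)" if "j \<in> I" for j
    unfolding K_def by (rule fsubspace_line[OF range_fvec[OF that u(1)[OF that]]])
  have S: "fsubspace d S"
    unfolding fsubspace_def S_def using fsubspaceD(3,4,5)[OF K]
    by (auto simp: mult_mat_zero_vec[OF block_carrier(4)] mult_add_distrib_mat_vec[OF block_carrier(4)]
        mult_mat_vec[OF block_carrier(4)] fvec_carrier)
  have uS: "u i \<in> S" if "i \<in> I" for i
    using u(3)[OF that] range_fvec[OF that u(1)[OF that]] by (auto simp: S_def K_def)
  have inv: "gram (D j) *\<^sub>v s \<in> S" if j: "j \<in> I" and s: "s \<in> S" for j s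
  proof -
    obtain c where "c \<in> F" "gram (D j) *\<^sub>v s = c \<cdot>\<^sub>v u j" using j s by (auto simp: S_def K_def)
    then show ?thesis using fsubspaceD(5)[OF S _ uS[OF j]] by simp
  qed
  from invariant_subspace_yields_row_separation[OF S inv]
  obtain E H L Bs t T where T: "row_separation_solution F d D I E H L Bs" "t < length Bs"
    "T = col_space F (cnj_mat L * (block_row Bs t)\<^sup>T)" "fsubspace d T" "T \<subseteq> S"
    "\<And>j s. j \<in> I \<Longrightarrow> s \<in> S \<Longrightarrow> gram (D j) *\<^sub>v s \<in> T" by metis
  have uT: "u j \<in> T" if j: "j \<in> I" for j
  proof -
    have "a j \<cdot>\<^sub>v u j \<in> T" using T(6)[OF j uS[OF j]] gram_range[OF j u(1)[OF j]] by simp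
    then have "inverse (a j) \<cdot>\<^sub>v (a j \<cdot>\<^sub>v u j) \<in> T"
      using fsubspaceD(5)[OF T(4) F_closed(8)[OF scale(1)[OF j]]] by simp
    then show ?thesis using scale(2)[OF j] by (simp add: smult_smult_assoc)
  qed
  have "T \<noteq> {0\<^sub>v d}" using uT[OF h] u(2)[OF h] by auto
  then have "row_separation_subspace F d D I T" using T unfolding row_separation_subspace_def by blast
  moreover have "v \<in> T"
    using v'(3) u(4) fsubspaceD(3)[OF T(4)] fsubspaceD(5)[OF T(4) _ uT[OF h]] by auto
  moreover have "fdim F d (T \<inter> range_of j) = 1" if j: "j \<in> I" for j
  proof (rule fdim_eq_1I)
    show "fsubspace d (T \<inter> range_of j)" by (rule fsubspace_inter[OF T(4) fsubspace_range[OF j]])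
    show "u j \<in> T \<inter> range_of j" "u j \<noteq> 0\<^sub>v d" using uT u j by auto
    fix y assume y: "y \<in> T \<inter> range_of j"
    then have "gram (D j) *\<^sub>v y \<in> K j" using T(5) j by (auto simp: S_def)
    then obtain c where c: "c \<in> F" "a j \<cdot>\<^sub>v y = c \<cdot>\<^sub>v u j" using gram_range[OF j] y by (auto simp: K_def)
    have "y = inverse (a j) \<cdot>\<^sub>v (a j \<cdot>\<^sub>v y)" using scale(2)[OF j] by (simp add: smult_smult_assoc)
    then have "y = (inverse (a j) * c) \<cdot>\<^sub>v u j" using c(2) by (simp add: smult_smult_assoc)
    then show "\<exists>c\<in>F. y = c \<cdot>\<^sub>v u j" using c(1) scale(1)[OF j] by (intro bexI[of _ "inverse (a j) * c"]) auto
  qed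
  ultimately show "\<exists>S. row_separation_subspace F d D (set js) S \<and> v \<in> S \<and>
      (\<forall>j\<in>set js. fdim F d (S \<inter> col_space F ((D j)\<^sup>T)) = 1)"
    unfolding setjs by blast
qed

end

section \<open>Division problems\<close>

text \<open>The matrix is Hermitian, hence a scalar by its single eigenvalue. The scalar is the squared
  length of every row and lies on the diagonal; if it were zero, the block would vanish.\<close>

lemma (in ground_field) one_eigenvalue_imp_scaled_coisometry:
  assumes A: "A \<in> fmat F n d" and one: "card (spectrum (cnj_mat A * A\<^sup>T)) = 1"
    and rank: "2 \<le> mat_rank A" and n: "0 < n"
  obtains c where "c \<in> F" "c \<noteq> 0" "cnj_mat A * A\<^sup>T = c \<cdot>\<^sub>m 1\<^sub>m n"
proof -
  have Ac: "A \<in> carrier_mat n d" by (rule fmat_carrier[OF A])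
  define K where "K = cnj_mat A * A\<^sup>T"
  have K: "K \<in> fmat F n n" unfolding K_def using A by (intro fmat_mult[of _ n d]) auto
  have Kc: "K \<in> carrier_mat n n" by (rule fmat_carrier[OF K])
  have Kij: "K $$ (i, l) = row A l \<bullet>c row A i" if "i < n" "l < n" for i l
    using that Ac by (auto simp: K_def scalar_prod_def mult.commute)
  have "adj K = K"
  proof (rule eq_matI)
    fix i l assume il: "i < dim_row K" "l < dim_col K"
    then have "row A i \<in> carrier_vec d" "row A l \<in> carrier_vec d" using Ac Kc by auto
    then show "adj K $$ (i, l) = K $$ (i, l)"
      using il Kc Kij cscalar_prod_simps(6)[of "row A i" d _ "row A l"] by auto
  qed (use Kc in auto)
  moreover obtain c where "spectrum K = {c}" using one by (auto simp: K_def card_1_singleton_iff)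
  ultimately have c: "K = c \<cdot>\<^sub>m 1\<^sub>m n" using normal_single_eigenvalue[OF Kc, of c] by simp
  have "c = K $$ (0, 0)" using n by (simp add: c)
  then have "c \<in> F" using K n by (auto simp: fmat_iff)
  moreover have "c \<noteq> 0"
  proof
    assume "c = 0"
    have row0: "row A i = 0\<^sub>v d" if "i < n" for i
    proof -
      have "row A i \<bullet>c row A i = 0" using Kij[OF that that] that \<open>c = 0\<close> by (simp add: c)
      then show ?thesis using Ac that conjugate_square_eq_0_vec[of "row A i" d] by auto
    qed
    have zero: "A = 0\<^sub>m n d"
    proof (rule eq_matI)
      fix i l assume "i < dim_row (0\<^sub>m n d :: complex mat)" "l < dim_col (0\<^sub>m n d :: complex mat)"
      then have "i < n" "l < d" by auto
      then show "A $$ (i, l) = 0\<^sub>m n d $$ (i, l)" using arg_cong[OF row0, of i "\<lambda>v. v $ l"] Ac by simp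
    qed (use Ac in auto)
    interpret vec_space "TYPE(complex)" n .
    have "mat_rank A = 0" using rank_0I[of d] by (simp add: zero mat_rank_def)
    with rank show False by simp
  qed
  ultimately show ?thesis using that c by (simp add: K_def)
qed

lemma division_imp_division_2:
  "division F d D I (Suc (Suc c)) \<Longrightarrow> division F d D I (Suc (Suc 0))"
proof (induction c)
  case (Suc c)
  have "division F d D I (Suc (Suc c))" using Suc.prems by (cases c) auto
  then show ?case by (rule Suc.IH)
qed

theorem theorem4p29:
  fixes F :: "complex set" and k d :: nat and D :: "nat \<Rightarrow> complex mat"
  assumes "F = \<real> \<or> F = UNIV"
    and "k \<ge> 2"
    and "row_separation_problem F d D {1..k+1}"
    and "division F d D {1..k+1} k \<or> (k \<ge> 3 \<and> loose_division F d D {1..k+1} k)"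
  shows "division F d D {1..k+1} (k+1) \<or> loose_division F d D {1..k+1} (k+1) \<longleftrightarrow>
    (\<forall>js. length js = k+1 \<and> distinct js \<and> set js = {1..k+1} \<longrightarrow>
      one_nonzero_eigenvalue_at_most (cov D js))"
proof -
  define I where "I = {1..k+1}"
  have I: "finite I" "card I = k + 1" "I \<noteq> {}" by (auto simp: I_def)
  note hyp = assms(3,4)[folded I_def]
  obtain k' where k': "k = Suc (Suc k')" using assms(2) by (metis add_2_eq_Suc le_Suc_ex)
  have base: "division F d D I 1" "\<And>i j. i \<in> I \<Longrightarrow> j \<in> I \<Longrightarrow> one_singular_value F (cnj_mat (D i) * (D j)\<^sup>T)"
    and connected: "division F d D I k \<Longrightarrow> division_graph_connected D I"
    using hyp(2) division_imp_division_2[of F d D I k'] by (auto simp: k' loose_division_def)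
  interpret ground_field F by unfold_locales (rule assms(1))
  have block: "D j \<in> fmat F (dim_row (D j)) d" "2 \<le> dim_row (D j)" if "j \<in> I" for j
    using hyp(1) base(1) that by (auto simp: row_separation_problem_def)
  have "\<exists>c. c \<in> F \<and> c \<noteq> 0 \<and> cnj_mat (D j) * (D j)\<^sup>T = c \<cdot>\<^sub>m 1\<^sub>m (dim_row (D j))" if j: "j \<in> I" for j
  proof -
    have "card (spectrum (cnj_mat (D j) * (D j)\<^sup>T)) = 1" "2 \<le> mat_rank (D j)"
      using base(1) j by auto
    then show ?thesis
      using one_eigenvalue_imp_scaled_coisometry[OF block(1)[OF j]] block(2)[OF j] by (metis less_le_trans zero_less_numeral)
  qed
  then obtain a where a: "\<And>j. j \<in> I \<Longrightarrow> a j \<in> F \<and> a j \<noteq> 0 \<and> cnj_mat (D j) * (D j)\<^sup>T = a j \<cdot>\<^sub>m 1\<^sub>m (dim_row (D j))"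
    by metis
  interpret isoclinic_family F d "\<lambda>j. dim_row (D j)" D I a
    by unfold_locales (use I block a base(2) in auto)
  let ?cov = "\<forall>js. length js = k+1 \<and> distinct js \<and> set js = I \<longrightarrow> one_nonzero_eigenvalue_at_most (cov D js)"
  have cov_iff: "?cov \<longleftrightarrow> (\<forall>js. distinct js \<and> set js = I \<longrightarrow> scalar_cycle js)"
  proof -
    have "length js = k + 1" if "distinct js" "set js = I" for js
      using that I(2) distinct_card by fastforce
    moreover have "one_nonzero_eigenvalue_at_most (cov D js) \<longleftrightarrow> scalar_cycle js" if "set js = I" for js
      using cov_eigenvalue_iff_scalar_cycle[of js] that I(3) by auto
    ultimately show ?thesis by blast
  qed
  \<comment> \<open>the covariance matrix of a triple is the product in the definition of a 3-division problem\<close>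
  have triple: "gram (D x) * gram (D y) * gram (D z) * gram (D x) = cov D [x, y, z]"
    if "x \<in> I" "y \<in> I" "z \<in> I" for x y z
    using block_carrier(4)[OF that(1)] block_carrier(4)[OF that(2)] block_carrier(4)[OF that(3)]
    by (simp add: cov_def assoc_mult_mat[of _ d d _ d _ d])
  have division_3_cycle: "scalar_cycle js"
    if div: "division F d D I (Suc (Suc (Suc 0)))" and js: "set js \<subseteq> I" "length js = 3" for js
  proof -
    obtain x y z where xyz: "js = [x, y, z]" using js(2) by (auto simp: length_Suc_conv numeral_3_eq_3)
    then have "one_nonzero_eigenvalue_at_most (cov D js)" using div js(1) triple by auto
    then show ?thesis using cov_eigenvalue_iff_scalar_cycle[of js] js xyz by simp
  qed
  have "division F d D I (k+1) \<or> loose_division F d D I (k+1) \<longleftrightarrow> ?cov"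
  proof (cases "k = 2")
    case True
    then have div2: "division F d D I (Suc (Suc 0))" using hyp(2) by (auto simp: numeral_2_eq_2)
    have "\<not> loose_division F d D I (k+1)" using div2 by (simp add: loose_division_def)
    moreover have "division F d D I (k+1) \<longleftrightarrow> ?cov"
    proof
      assume "division F d D I (k+1)"
      then have "division F d D I (Suc (Suc (Suc 0)))" using True by (simp add: numeral_3_eq_3)
      from division_3_cycle[OF this] have "scalar_cycle js" if "distinct js" "set js = I" for js
        using that distinct_card[OF that(1)] I(2) True by simp
      then show ?cov using cov_iff by blast
    next
      assume ?cov
      have distinct: "scalar_cycle js" if js: "js \<noteq> []" "set js \<subseteq> I" "distinct js" for js
      proof (cases "length js \<le> 2")
        case False
        then have "card I \<le> card (set js)" using js True I(2) by (simp add: distinct_card)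
        then have "set js = I" using card_seteq[OF I(1) js(2)] by simp
        then show ?thesis using \<open>?cov\<close> cov_iff js by blast
      qed (rule scalar_cycle_short[OF js(1,2)])
      have "one_nonzero_eigenvalue_at_most (cov D [x, y, z])" if "x \<in> I" "y \<in> I" "z \<in> I" for x y z
        using that all_scalar_if_distinct_scalar[OF distinct, of "[x, y, z]"]
          cov_eigenvalue_iff_scalar_cycle[of "[x, y, z]"] by simp
      then have "division F d D I (Suc (Suc (Suc 0)))" using div2 triple by auto
      then show "division F d D I (k+1)" using True by (simp add: numeral_3_eq_3)
    qed
    ultimately show ?thesis by blast
  next
    case False
    then obtain m where m: "k = Suc (Suc (Suc m))" using assms(2) k' by (cases k') auto
    have "division F d D I (k+1) \<or> loose_division F d D I (k+1) \<longleftrightarrow> collection_condition F d D I (k+1)"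
      using hyp(2) connected by (auto simp: m loose_division_def)
    moreover have proper: "scalar_cycle js" if js: "js \<noteq> []" "set js \<subseteq> I" "distinct js" "set js \<noteq> I" for js
    proof -
      obtain x where x: "x \<in> I" "x \<notin> set js" using js by blast
      have J: "set js \<subseteq> I - {x}" "I - {x} \<subseteq> I" "card (I - {x}) = k" using x js I by auto
      show ?thesis
      proof (cases "collection_condition F d D I k")
        case True then show ?thesis using collection_condition_scalar_cycle[OF True js(1) J] by blast
      next
        case False
        \<comment> \<open>the only hypothesis without a collection condition is that of a 3-division problem\<close>
        then have "division F d D I k" and "m = 0"
          using hyp(2) by (auto simp: m loose_division_def) (cases m; auto)
        moreover have "length js \<le> 3"
          using distinct_card[OF js(3)] card_mono[OF _ J(1)] J(3) I(1) m \<open>m = 0\<close> by simp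
        ultimately show ?thesis
          using division_3_cycle[OF _ js(2)] scalar_cycle_short[OF js(1,2)] m by (cases "length js = 3") auto
      qed
    qed
    moreover have "collection_condition F d D I (k+1) \<longleftrightarrow> ?cov"
    proof
      assume coll: "collection_condition F d D I (k+1)"
      have "scalar_cycle js" if "set js = I" for js
        using collection_condition_scalar_cycle[OF coll, of js I] that I by auto
      then show ?cov unfolding cov_iff by blast
    next
      assume ?cov
      then have "scalar_cycle js" if "js \<noteq> []" "set js \<subseteq> I" "distinct js" for js
        using that proper cov_iff by (cases "set js = I") blast+
      then have "scalar_cycle js" if "js \<noteq> []" "set js \<subseteq> I" for js
        using all_scalar_if_distinct_scalar[of js] that by blast
      then show "collection_condition F d D I (k+1)"
        using collection_condition_if_all_scalar I by metis
    qed
    ultimately show ?thesis by blast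
  qed
  then show ?thesis by (simp add: I_def)
qed

end
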